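(* Let $\{S_e : e\in\mathcal{E}\}$ be a strongly connected graph directed iterated function system (GD-IFS) in $\mathbb{R}^d$ with attractor $(K_1,\ldots,K_q)$, such that at least one $K_i$ contains at least two points, let $j\in\mathcal{V}=\{1,\dots,q\}$ and assume that $\mathcal{T}_{j,G}$ is a finite group. Then for every $\varepsilon>0$ and every $O\in\mathcal{T}_{j,G}$ there exist $r\in(0,1)$ and a self-similar iterated function system (SS-IFS) $\{S_i\}_{i=1}^m$, $S_i(x)=r_iT_i(x)+v_i$, in $\mathbb{R}^d$ that satisfies the strong separation condition, with attractor $K$, such that $K\subseteq K_j$, $\dim_H K_j-\varepsilon<\dim_H K$, and $T_i=O$ and $r_i=r$ for every $i\in\{1,\dots,m\}$.
   Context: Self-similar systems. An SS-IFS in $\mathbb{R}^d$ is a finite collection $\{S_i\}_{i=1}^m$ of contracting similarities of $\mathbb{R}^d$; write $S_i(x)=r_iT_i(x)+v_i$ with $0<r_i<1$, $T_i\in\mathbb{O}_d$ (the orthogonal group), $v_i\in\mathbb{R}^d$. Its attractor is the unique nonempty compact $K$ with $K=\bigcup_{i=1}^m S_i(K)$. The strong separation condition (SSC) means that the sets $S_1(K),\dots,S_m(K)$ are pairwise disjoint. Graph directed systems. Let $G(\mathcal{V},\mathcal{E})$ be a directed graph with vertex set $\mathcal{V}=\{1,\ldots,q\}$ and finite set $\mathcal{E}$ of directed edges (several edges between two vertices and loops are allowed) such that at least one edge starts from each vertex. $\mathcal{E}_{i,j}$ is the set of edges from $i$ to $j$, and $\mathcal{E}_{i,j}^k$ is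 the set of sequences $(e_1,\ldots,e_k)$ of $k$ edges forming a directed path from $i$ to $j$. A GD-IFS in $\mathbb{R}^d$ is a collection $\{S_e:e\in\mathcal{E}\}$ of contracting similarities of $\mathbb{R}^d$; write $S_e(x)=r_eT_e(x)+v_e$ with $0<r_e<1$, $T_e\in\mathbb{O}_d$, $v_e\in\mathbb{R}^d$. Its attractor is the unique $q$-tuple $(K_1,\ldots,K_q)$ of nonempty compact sets with $K_i=\bigcup_{j=1}^q\bigcup_{e\in\mathcal{E}_{i,j}}S_e(K_j)$ for all $i$. It is strongly connected if for every pair of vertices $i,j$ there is a directed path from $i$ to $j$ and one from $j$ to $i$. $\mathcal{C}_j=\bigcup_{k\ge1}\mathcal{E}_{j,j}^k$ is the set of directed cycles starting and ending at $j$, and $\mathcal{T}_{j,G}$, the $j$-th transformation group, is the group generated by $\{T_{e_1}\circ\cdots\circ T_{e_k}:(e_1,\ldots,e_k)\in\mathcal{C}_j\}$. $\dim_H$ is Hausdorff dimension. *)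

theory Defs
  imports
    "HOL-Analysis.Analysis"
    "HOL-Algebra.Generated_Groups"
    "Graph_Theory.Digraph_Component"
begin

section \<open>Hausdorff dimension\<close>

text \<open>
  The summand \<open>(diam U)\<^sup>s\<close>, with the usual conventions that the empty set contributes 0 and that
  \<open>(diam U)\<^sup>0 = 1\<close> for nonempty \<open>U\<close> (note that \<open>0 powr 0 = 0\<close> in HOL).
\<close>

definition diam_pow :: "real \<Rightarrow> 'a::metric_space set \<Rightarrow> ennreal" where
  "diam_pow s U = ennreal (if U = {} then 0 else if s = 0 then 1 else diameter U powr s)"

text \<open>
  Boundedness is required because \<open>diameter\<close> is unspecified on unbounded sets. Finite covers are
  included, since \<open>U n\<close> may be empty.
\<close>

definition hausdorff_premeasure :: "real \<Rightarrow> real \<Rightarrow> 'a::metric_space set \<Rightarrow> ennreal" where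
  "hausdorff_premeasure s \<delta> A =
     (INF U \<in> {U :: nat \<Rightarrow> 'a set. A \<subseteq> (\<Union>n. U n) \<and> (\<forall>n. bounded (U n) \<and> diameter (U n) \<le> \<delta>)}.
        \<Sum>n. diam_pow s (U n))"

definition hausdorff_measure :: "real \<Rightarrow> 'a::metric_space set \<Rightarrow> ennreal" where
  "hausdorff_measure s A = (SUP \<delta> \<in> {0<..}. hausdorff_premeasure s \<delta> A)"

definition hausdorff_dim :: "'a::metric_space set \<Rightarrow> ereal" where
  "hausdorff_dim A = (INF s \<in> {s. 0 \<le> s \<and> hausdorff_measure s A = 0}. ereal s)"


section \<open>Similarities and the orthogonal group\<close>

definition similarity :: "real \<Rightarrow> ('a \<Rightarrow> 'a) \<Rightarrow> 'a \<Rightarrow> 'a \<Rightarrow> 'a::euclidean_space" where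
  "similarity r T v x = r *\<^sub>R T x + v"

definition orthogonal_group :: "('a::euclidean_space \<Rightarrow> 'a) monoid" where
  "orthogonal_group = \<lparr>carrier = {T. orthogonal_transformation T}, mult = (\<circ>), one = id\<rparr>"

lemma group_orthogonal_group: "group orthogonal_group"
proof (rule groupI)
  fix T :: "'a \<Rightarrow> 'a"
  assume "T \<in> carrier orthogonal_group"
  then have T: "orthogonal_transformation T" by (simp add: orthogonal_group_def)
  have "orthogonal_transformation (inv_into UNIV T)"
    using T by (rule orthogonal_transformation_inv)
  moreover have "inv_into UNIV T \<circ> T = id"
    using orthogonal_transformation_inj[OF T] by simp
  ultimately show "\<exists>S\<in>carrier orthogonal_group. S \<otimes>\<^bsub>orthogonal_group\<^esub> T = \<one>\<^bsub>orthogonal_group\<^esub>"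
    by (auto simp: orthogonal_group_def)
qed (auto simp: orthogonal_group_def comp_assoc orthogonal_transformation_compose
      id_def)


section \<open>Self-similar systems\<close>

definition ss_ifs ::
  "nat \<Rightarrow> (nat \<Rightarrow> real) \<Rightarrow> (nat \<Rightarrow> 'a \<Rightarrow> 'a) \<Rightarrow> (nat \<Rightarrow> 'a::euclidean_space) \<Rightarrow> bool" where
  "ss_ifs m r T v \<longleftrightarrow>
     1 \<le> m \<and> (\<forall>i\<in>{1..m}. 0 < r i \<and> r i < 1 \<and> orthogonal_transformation (T i))"

definition ss_attractor ::
  "nat \<Rightarrow> (nat \<Rightarrow> real) \<Rightarrow> (nat \<Rightarrow> 'a \<Rightarrow> 'a) \<Rightarrow> (nat \<Rightarrow> 'a::euclidean_space) \<Rightarrow> 'a set \<Rightarrow> bool" where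
  "ss_attractor m r T v K \<longleftrightarrow>
     K \<noteq> {} \<and> compact K \<and> K = (\<Union>i\<in>{1..m}. similarity (r i) (T i) (v i) ` K)"

definition strong_separation ::
  "nat \<Rightarrow> (nat \<Rightarrow> real) \<Rightarrow> (nat \<Rightarrow> 'a \<Rightarrow> 'a) \<Rightarrow> (nat \<Rightarrow> 'a::euclidean_space) \<Rightarrow> 'a set \<Rightarrow> bool" where
  "strong_separation m r T v K \<longleftrightarrow>
     disjoint_family_on (\<lambda>i. similarity (r i) (T i) (v i) ` K) {1..m}"


section \<open>Graph directed systems\<close>

text \<open>
  An edge \<open>e\<close> goes from \<open>tail G e\<close> to \<open>head G e\<close>. Loops and parallel edges are allowed in
  \<open>fin_digraph\<close>.
\<close>

definition gd_ifs ::
  "('v, 'e) pre_digraph \<Rightarrow> ('e \<Rightarrow> real) \<Rightarrow> ('e \<Rightarrow> 'a \<Rightarrow> 'a) \<Rightarrow> ('e \<Rightarrow> 'a::euclidean_space) \<Rightarrow> bool" where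
  "gd_ifs G r T v \<longleftrightarrow>
     fin_digraph G \<and> (\<forall>i\<in>verts G. out_arcs G i \<noteq> {}) \<and>
     (\<forall>e\<in>arcs G. 0 < r e \<and> r e < 1 \<and> orthogonal_transformation (T e))"

definition edges_between :: "('v, 'e) pre_digraph \<Rightarrow> 'v \<Rightarrow> 'v \<Rightarrow> 'e set" where
  "edges_between G i j = {e \<in> arcs G. tail G e = i \<and> head G e = j}"

definition gd_attractor ::
  "('v, 'e) pre_digraph \<Rightarrow> ('e \<Rightarrow> real) \<Rightarrow> ('e \<Rightarrow> 'a \<Rightarrow> 'a) \<Rightarrow> ('e \<Rightarrow> 'a::euclidean_space) \<Rightarrow>
     ('v \<Rightarrow> 'a set) \<Rightarrow> bool" where
  "gd_attractor G r T v K \<longleftrightarrow>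
     (\<forall>i\<in>verts G. K i \<noteq> {} \<and> compact (K i) \<and>
        K i = (\<Union>j\<in>verts G. \<Union>e\<in>edges_between G i j. similarity (r e) (T e) (v e) ` K j))"

definition directed_cycles :: "('v, 'e) pre_digraph \<Rightarrow> 'v \<Rightarrow> 'e list set" where
  "directed_cycles G j = {p. p \<noteq> [] \<and> pre_digraph.awalk G j p j}"

text \<open>\<open>path_map T [e\<^sub>1, \<dots>, e\<^sub>k] = T e\<^sub>1 \<circ> \<dots> \<circ> T e\<^sub>k\<close>\<close>

definition path_map :: "('e \<Rightarrow> 'a \<Rightarrow> 'a) \<Rightarrow> 'e list \<Rightarrow> 'a \<Rightarrow> 'a" where
  "path_map T p = foldr (\<lambda>e f. T e \<circ> f) p id"

definition transformation_group ::
  "('v, 'e) pre_digraph \<Rightarrow> ('e \<Rightarrow> 'a \<Rightarrow> 'a) \<Rightarrow> 'v \<Rightarrow> ('a::euclidean_space \<Rightarrow> 'a) set" where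
  "transformation_group G T j = generate orthogonal_group (path_map T ` directed_cycles G j)"

end

theory Submission
  imports Defs "HOL-Real_Asymp.Real_Asymp"
begin

text \<open>
  Let \<open>t\<close> be the dimension of \<open>K j\<close>. A cycle at \<open>j\<close> is a similarity mapping \<open>K j\<close> into itself, so any
  finite family of cycles at \<open>j\<close> is a self-similar system whose attractor lies in \<open>K j\<close>
  (\<open>ss_attractor_exists_within\<close>), and it satisfies the strong separation condition as soon as the
  images of \<open>K j\<close> are disjoint. If moreover the \<open>m\<close> cycles have the same ratio \<open>\<rho>\<close>, the attractor has
  dimension at least \<open>s\<close> whenever \<open>s > 0\<close> and \<open>m * \<rho> powr s \<ge> 1\<close>
  (\<open>strong_separation_hausdorff_dim_ge\<close>). So one needs many cycles at \<open>j\<close> with disjoint images, the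
  same ratio and the prescribed linear part \<open>Q\<close>.

  Disjointness comes from the dimension. For \<open>0 < s < t\<close> the \<open>s\<close>-dimensional measure of \<open>K j\<close> is
  not zero, hence for small \<open>\<delta>\<close> there are at least of the order of \<open>\<delta> powr (-s)\<close> points of \<open>K j\<close> that
  are pairwise further apart than \<open>2 * D * \<delta>\<close> (\<open>positive_measure_many_separated_points\<close>), and
  cylinders of diameter at most \<open>D * \<delta>\<close> containing them are disjoint, however much the cylinders of
  the given system overlap otherwise.

  The linear part is corrected with the finiteness of the group: every element of the
  transformation group is then the linear part of one cycle, inverses included
  (\<open>finite_transformation_group_eq\<close>). Extending the walk that defines a cylinder back to \<open>j\<close> and by
  one of finitely many correcting cycles yields the linear part \<open>Q\<close> and changes the ratio by a
  bounded factor only (\<open>cycle_with_rotation_at_point\<close>).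

  The ratio is made constant by the pigeonhole principle: a walk with ratio of order \<open>\<delta>\<close> has length
  \<open>O(ln (1/\<delta>))\<close>, and its ratio depends only on how often each edge occurs, so the ratios take only
  polynomially many values in \<open>ln (1/\<delta>)\<close> (\<open>card_walk_ratios_le\<close>). Keeping the most frequent one
  costs a factor smaller than any negative power of \<open>\<delta>\<close> (\<open>disjoint_equal_cycles_exist\<close>).
\<close>


section \<open>Hausdorff measure and separated points\<close>

lemma diameter_leI:
  fixes S :: "'a::metric_space set"
  assumes "0 \<le> d" and "\<And>x y. x \<in> S \<Longrightarrow> y \<in> S \<Longrightarrow> dist x y \<le> d"
  shows "diameter S \<le> d"
  using assms by (auto simp: diameter_def intro!: cSUP_least)

text \<open>
  The finite cover is padded to a sequence by empty sets, for which \<open>diam_pow\<close> is \<open>0\<close>.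
\<close>

lemma hausdorff_premeasure_finite_cover:
  fixes A :: "'a::metric_space set"
  assumes s: "0 < s" and F: "finite F" and cover: "A \<subseteq> (\<Union>x\<in>F. U x)"
    and U: "\<And>x. x \<in> F \<Longrightarrow> bounded (U x) \<and> diameter (U x) \<le> \<delta>" and \<delta>: "0 \<le> \<delta>"
  shows "hausdorff_premeasure s \<delta> A \<le> ennreal (real (card F) * \<delta> powr s)"
proof -
  obtain h where h: "bij_betw h {..<card F} F"
    using F bij_betw_from_nat_into_finite by blast
  define V where "V n = (if n < card F then U (h n) else {})" for n
  have hF: "h n \<in> F" if "n < card F" for n
    using h that by (auto simp: bij_betw_def)
  have "A \<subseteq> (\<Union>n. V n)"
  proof
    fix a assume "a \<in> A"
    then obtain x where x: "x \<in> F" "a \<in> U x" using cover by auto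
    then obtain n where "n < card F" "x = h n" using h by (auto simp: bij_betw_def)
    then show "a \<in> (\<Union>n. V n)" using x by (auto simp: V_def intro!: exI[of _ n])
  qed
  moreover have "\<forall>n. bounded (V n) \<and> diameter (V n) \<le> \<delta>"
    using U hF \<delta> by (auto simp: V_def)
  ultimately have "hausdorff_premeasure s \<delta> A \<le> (\<Sum>n. diam_pow s (V n))"
    unfolding hausdorff_premeasure_def by (intro INF_lower) auto
  also have "\<dots> = (\<Sum>n<card F. diam_pow s (V n))"
    by (rule suminf_finite) (auto simp: V_def diam_pow_def)
  also have "\<dots> \<le> (\<Sum>n<card F. ennreal (\<delta> powr s))"
  proof (rule sum_mono)
    fix n assume "n \<in> {..<card F}"
    then have "bounded (V n)" "diameter (V n) \<le> \<delta>" using U hF by (auto simp: V_def)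
    then show "diam_pow s (V n) \<le> ennreal (\<delta> powr s)"
      using s by (auto simp: diam_pow_def intro!: ennreal_leI powr_mono2 diameter_ge_0)
  qed
  also have "\<dots> = ennreal (real (card F) * \<delta> powr s)"
    by (simp add: ennreal_mult ennreal_of_nat_eq_real_of_nat)
  finally show ?thesis .
qed

text \<open>
  A cover by finitely many balls of radius \<open>\<eta>/2\<close> bounds the cardinality of \<open>\<eta>\<close>-separated subsets,
  so one of largest cardinality exists. It is an \<open>\<eta>\<close>-net, since any uncovered point could be added.
\<close>

lemma compact_maximal_separated_subset:
  fixes A :: "'a::metric_space set"
  assumes A: "compact A" and \<eta>: "0 < \<eta>"
  obtains P where "finite P" "P \<subseteq> A" "\<And>x y. x \<in> P \<Longrightarrow> y \<in> P \<Longrightarrow> x \<noteq> y \<Longrightarrow> \<eta> < dist x y"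
    "A \<subseteq> (\<Union>x\<in>P. cball x \<eta>)"
proof -
  obtain C where C: "finite C" "A \<subseteq> (\<Union>x\<in>C. ball x (\<eta>/2))"
  proof -
    have "A \<subseteq> (\<Union>x\<in>A. ball x (\<eta>/2))" using \<eta> by auto
    then obtain C' where "C' \<subseteq> A" "finite C'" "A \<subseteq> (\<Union>x\<in>C'. ball x (\<eta>/2))"
      by (rule compactE_image[OF A open_ball])
    then show ?thesis by (intro that)
  qed
  define sep where "sep P \<longleftrightarrow> finite P \<and> P \<subseteq> A \<and> (\<forall>x\<in>P. \<forall>y\<in>P. x \<noteq> y \<longrightarrow> \<eta> < dist x y)" for P
  have bound: "card P \<le> card C" if "sep P" for P
  proof -
    have "P \<subseteq> (\<Union>x\<in>C. ball x (\<eta>/2))" using that C(2) unfolding sep_def by (meson order_trans)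
    then have "\<forall>x\<in>P. \<exists>c\<in>C. x \<in> ball c (\<eta>/2)" by (meson UN_E subsetD)
    then obtain f where f: "\<forall>x\<in>P. f x \<in> C \<and> x \<in> ball (f x) (\<eta>/2)"
      using bchoice[of P "\<lambda>x c. c \<in> C \<and> x \<in> ball c (\<eta>/2)"] by blast
    have "inj_on f P"
    proof (rule inj_onI, rule ccontr)
      fix x y assume xy: "x \<in> P" "y \<in> P" "f x = f y" "x \<noteq> y"
      have "dist x y \<le> dist (f x) x + dist (f x) y" by (metis dist_commute dist_triangle)
      moreover have "dist (f x) x < \<eta>/2" "dist (f x) y < \<eta>/2"
        using f xy(1-3) by auto
      moreover have "\<eta> < dist x y" using that xy unfolding sep_def by blast
      ultimately show False by linarith
    qed
    then show ?thesis using f C(1) by (intro card_inj_on_le[of f]) auto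
  qed
  have "sep {}" by (auto simp: sep_def)
  then obtain P where P: "sep P" and max: "\<And>Q. sep Q \<Longrightarrow> card Q \<le> card P"
    using ex_has_greatest_nat[of sep "{}" card "Suc (card C)"] bound
    by (metis le_imp_less_Suc)
  have cover: "A \<subseteq> (\<Union>x\<in>P. cball x \<eta>)"
  proof (rule ccontr)
    assume "\<not> ?thesis"
    then obtain a where a: "a \<in> A" "\<And>x. x \<in> P \<Longrightarrow> a \<notin> cball x \<eta>" by blast
    then have a': "\<And>x. x \<in> P \<Longrightarrow> \<eta> < dist x a" by fastforce
    then have "sep (insert a P)" using P a(1) unfolding sep_def by (auto simp: dist_commute)
    moreover have "a \<notin> P" using a'[of a] \<eta> by auto
    ultimately show False using max[of "insert a P"] P by (auto simp: sep_def)
  qed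
  show ?thesis
    by (rule that[OF _ _ _ cover]) (use P in \<open>simp_all add: sep_def\<close>)
qed

lemma hausdorff_premeasure_antimono:
  assumes "\<delta> \<le> \<delta>'"
  shows "hausdorff_premeasure s \<delta>' A \<le> hausdorff_premeasure s \<delta> A"
  unfolding hausdorff_premeasure_def using assms by (intro INF_superset_mono) (auto intro: order_trans)

text \<open>
  A maximal \<open>\<eta>\<close>-separated set yields a cover by balls of radius \<open>\<eta>\<close>. If the \<open>s\<close>-dimensional measure
  does not vanish, such a cover cannot be cheap, hence it has at least of the order of
  \<open>\<eta> powr (-s)\<close> members. This is the only way in which the dimension of the ambient attractor
  enters the main argument.
\<close>

lemma positive_measure_many_separated_points:
  fixes A :: "'a::metric_space set"
  assumes A: "compact A" and s: "0 < s" and H: "hausdorff_measure s A \<noteq> 0"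
  obtains c \<eta>\<^sub>0 where "0 < c" "0 < \<eta>\<^sub>0"
    "\<And>\<eta>. 0 < \<eta> \<Longrightarrow> \<eta> \<le> \<eta>\<^sub>0 \<Longrightarrow> \<exists>P. finite P \<and> P \<subseteq> A \<and>
       (\<forall>x\<in>P. \<forall>y\<in>P. x \<noteq> y \<longrightarrow> \<eta> < dist x y) \<and> c \<le> real (card P) * \<eta> powr s"
proof -
  obtain \<delta> where \<delta>: "0 < \<delta>" "hausdorff_premeasure s \<delta> A \<noteq> 0"
    using H unfolding hausdorff_measure_def
    by (metis (mono_tags, lifting) SUP_eq_const bot_ennreal greaterThan_iff greaterThan_non_empty)
  define b where "b = enn2real (min 1 (hausdorff_premeasure s \<delta> A))"
  have b: "0 < b" "ennreal b \<le> hausdorff_premeasure s \<delta> A"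
    using \<delta> unfolding b_def
    by (auto simp: enn2real_positive_iff min_less_iff_disj zero_less_iff_neq_zero
        ennreal_enn2real_if)
  show ?thesis
  proof
    show "0 < b / 2 powr s" "0 < \<delta> / 2" using b \<delta> by auto
    fix \<eta> assume \<eta>: "0 < \<eta>" "\<eta> \<le> \<delta> / 2"
    obtain P where P: "finite P" "P \<subseteq> A" "\<And>x y. x \<in> P \<Longrightarrow> y \<in> P \<Longrightarrow> x \<noteq> y \<Longrightarrow> \<eta> < dist x y"
      "A \<subseteq> (\<Union>x\<in>P. cball x \<eta>)"
      using compact_maximal_separated_subset[OF A \<eta>(1)] by metis
    have "diameter (cball x \<eta>) \<le> 2 * \<eta>" for x :: 'a
    proof (rule diameter_leI)
      fix y z assume "y \<in> cball x \<eta>" "z \<in> cball x \<eta>"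
      then show "dist y z \<le> 2 * \<eta>" using dist_triangle3[of y z x] by auto
    qed (use \<eta> in auto)
    then have "hausdorff_premeasure s (2 * \<eta>) A \<le> ennreal (real (card P) * (2 * \<eta>) powr s)"
      using P \<eta> s by (intro hausdorff_premeasure_finite_cover) auto
    moreover have "hausdorff_premeasure s \<delta> A \<le> hausdorff_premeasure s (2 * \<eta>) A"
      using \<eta> by (intro hausdorff_premeasure_antimono) auto
    ultimately have "ennreal b \<le> ennreal (real (card P) * (2 * \<eta>) powr s)"
      using b(2) by order
    then have "b \<le> real (card P) * (2 * \<eta>) powr s" by simp
    then have "b / 2 powr s \<le> real (card P) * \<eta> powr s"
      using \<eta> by (simp add: powr_mult field_simps)
    then show "\<exists>P. finite P \<and> P \<subseteq> A \<and> (\<forall>x\<in>P. \<forall>y\<in>P. x \<noteq> y \<longrightarrow> \<eta> < dist x y) \<and>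
        b / 2 powr s \<le> real (card P) * \<eta> powr s"
      using P by blast
  qed
qed

text \<open>
  Volume comparison: the balls of radius \<open>\<eta>/2\<close> about the points are disjoint and lie in a ball of
  radius \<open>2 * R\<close>.
\<close>

lemma separated_points_card_le:
  fixes P :: "'a::euclidean_space set"
  assumes P: "finite P" "P \<subseteq> ball 0 R" and \<eta>: "0 < \<eta>" "\<eta> \<le> R"
    and sep: "\<And>x y. x \<in> P \<Longrightarrow> y \<in> P \<Longrightarrow> x \<noteq> y \<Longrightarrow> \<eta> < dist x y"
  shows "real (card P) * \<eta> ^ DIM('a) \<le> (4 * R) ^ DIM('a)"
proof -
  let ?v = "measure lborel (ball (0::'a) 1)"
  have disj: "disjoint_family_on (\<lambda>x. ball x (\<eta>/2)) P"
    unfolding disjoint_family_on_def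
  proof (intro ballI impI, rule ccontr)
    fix x y assume xy: "x \<in> P" "y \<in> P" "x \<noteq> y" "ball x (\<eta>/2) \<inter> ball y (\<eta>/2) \<noteq> {}"
    then obtain z where "z \<in> ball x (\<eta>/2)" "z \<in> ball y (\<eta>/2)" by blast
    then have "dist x z < \<eta>/2" "dist y z < \<eta>/2" by simp_all
    then have "dist x y < \<eta>" by (metis dist_triangle_half_l dist_commute)
    then show False using sep[OF xy(1-3)] by simp
  qed
  have "real (card P) * ((\<eta>/2) ^ DIM('a) * ?v) = (\<Sum>x\<in>P. measure lborel (ball x (\<eta>/2)))"
  proof -
    have "measure lborel (ball x (\<eta>/2)) = (\<eta>/2) ^ DIM('a) * ?v" for x :: 'a
      using \<eta> by (intro content_ball_conv_unit_ball) auto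
    then show ?thesis by simp
  qed
  also have "\<dots> = measure lborel (\<Union>x\<in>P. ball x (\<eta>/2))"
  proof (rule measure_finite_Union[symmetric])
    show "emeasure lborel (ball x (\<eta>/2)) \<noteq> \<infinity>" for x :: 'a
      using emeasure_lborel_ball_finite[of x "\<eta>/2"] by (simp add: less_top)
  qed (use P disj in auto)
  also have "measure lborel (\<Union>x\<in>P. ball x (\<eta>/2)) \<le> measure lborel (ball (0::'a) (2 * R))"
  proof (rule measure_mono_fmeasurable)
    show "(\<Union>x\<in>P. ball x (\<eta>/2)) \<subseteq> ball 0 (2 * R)"
    proof
      fix z assume "z \<in> (\<Union>x\<in>P. ball x (\<eta>/2))"
      then obtain x where "x \<in> P" "dist x z < \<eta>/2" by auto
      moreover have "dist 0 z \<le> dist 0 x + dist x z" by (rule dist_triangle)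
      moreover have "dist 0 x < R" using P(2) \<open>x \<in> P\<close> by auto
      ultimately show "z \<in> ball 0 (2 * R)" using \<eta> by simp
    qed
    show "(\<Union>x\<in>P. ball x (\<eta>/2)) \<in> sets lborel" by (auto intro!: borel_open open_UN)
    show "ball (0::'a) (2 * R) \<in> fmeasurable lborel"
      using emeasure_lborel_ball_finite[of "0::'a" "2 * R"] by (intro fmeasurableI) simp_all
  qed
  also have "\<dots> = (2 * R) ^ DIM('a) * ?v"
    using \<eta> by (intro content_ball_conv_unit_ball) auto
  finally have "(real (card P) * (\<eta>/2) ^ DIM('a)) * ?v \<le> (2 * R) ^ DIM('a) * ?v"
    by (simp only: mult.assoc)
  then have "real (card P) * (\<eta>/2) ^ DIM('a) \<le> (2 * R) ^ DIM('a)"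
    using content_ball_pos[of 1 "0::'a"] by (simp only: mult_le_cancel_right_pos)
  then have "2 ^ DIM('a) * (real (card P) * (\<eta>/2) ^ DIM('a)) \<le> 2 ^ DIM('a) * (2 * R) ^ DIM('a)"
    by simp
  moreover have "2 ^ DIM('a) * (real (card P) * (\<eta>/2) ^ DIM('a)) = real (card P) * \<eta> ^ DIM('a)"
    by (simp add: power_divide)
  moreover have "2 ^ DIM('a) * (2 * R) ^ DIM('a) = (4 * R) ^ DIM('a)"
  proof -
    have "2 * (2 * R) = 4 * R" by simp
    then show ?thesis by (metis power_mult_distrib)
  qed
  ultimately show ?thesis by (simp only:)
qed

text \<open>
  Otherwise there would be of the order of \<open>\<eta> powr (-(DIM('a) + 1))\<close> points with mutual distance
  more than \<open>\<eta>\<close>, while volume leaves room for the order of \<open>\<eta> powr (-DIM('a))\<close> only. Hence the dimension of a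
  compact set is a real number and subtracting \<open>\<epsilon>\<close> really lowers it.
\<close>

lemma hausdorff_measure_compact_eq_0:
  fixes A :: "'a::euclidean_space set"
  assumes A: "compact A"
  shows "hausdorff_measure (real DIM('a) + 1) A = 0"
proof (rule ccontr)
  let ?s = "real DIM('a) + 1"
  assume "hausdorff_measure ?s A \<noteq> 0"
  then obtain c \<eta>\<^sub>0 where c: "0 < c" "0 < \<eta>\<^sub>0" and
    ex: "\<And>\<eta>. 0 < \<eta> \<Longrightarrow> \<eta> \<le> \<eta>\<^sub>0 \<Longrightarrow> \<exists>P. finite P \<and> P \<subseteq> A \<and>
       (\<forall>x\<in>P. \<forall>y\<in>P. x \<noteq> y \<longrightarrow> \<eta> < dist x y) \<and> c \<le> real (card P) * \<eta> powr ?s"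
    using positive_measure_many_separated_points[OF A, of ?s] by auto
  obtain R where R: "0 < R" "A \<subseteq> ball 0 R"
    using bounded_subset_ballD[OF compact_imp_bounded[OF A], of 0] by auto
  define \<eta> where "\<eta> = Min {\<eta>\<^sub>0, R, c / (2 * (4 * R) ^ DIM('a))}"
  have \<eta>: "0 < \<eta>" "\<eta> \<le> \<eta>\<^sub>0" "\<eta> \<le> R" "\<eta> \<le> c / (2 * (4 * R) ^ DIM('a))"
    using c R by (auto simp: \<eta>_def)
  obtain P where P: "finite P" "P \<subseteq> A" "\<And>x y. x \<in> P \<Longrightarrow> y \<in> P \<Longrightarrow> x \<noteq> y \<Longrightarrow> \<eta> < dist x y"
    "c \<le> real (card P) * \<eta> powr ?s" using ex[OF \<eta>(1,2)] by blast
  have "c \<le> real (card P) * \<eta> ^ DIM('a) * \<eta>"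
    using P(4) \<eta>(1) by (simp add: powr_add powr_realpow mult.assoc)
  also have "\<dots> \<le> (4 * R) ^ DIM('a) * \<eta>"
    using separated_points_card_le[OF P(1) order_trans[OF P(2) R(2)] \<eta>(1,3) P(3)] \<eta>(1)
    by (intro mult_right_mono) simp_all
  also have "\<dots> \<le> (4 * R) ^ DIM('a) * (c / (2 * (4 * R) ^ DIM('a)))"
    using \<eta> R by (intro mult_left_mono) auto
  also have "\<dots> = c / 2" using R by simp
  finally show False using c by simp
qed

lemma hausdorff_dim_nonneg: "0 \<le> hausdorff_dim A"
  unfolding hausdorff_dim_def by (auto intro!: INF_greatest)

lemma compact_hausdorff_dim_real:
  fixes A :: "'a::euclidean_space set"
  assumes "compact A"
  obtains t where "0 \<le> t" "hausdorff_dim A = ereal t"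
proof -
  have "hausdorff_dim A \<le> ereal (real DIM('a) + 1)"
    unfolding hausdorff_dim_def
    using hausdorff_measure_compact_eq_0[OF assms] by (intro INF_lower) auto
  then show ?thesis using that hausdorff_dim_nonneg[of A] by (cases "hausdorff_dim A") auto
qed

lemma hausdorff_measure_nonzero_below_dim:
  assumes "0 \<le> s" "ereal s < hausdorff_dim A"
  shows "hausdorff_measure s A \<noteq> 0"
proof
  assume "hausdorff_measure s A = 0"
  then have "hausdorff_dim A \<le> ereal s"
    unfolding hausdorff_dim_def using assms by (intro INF_lower) auto
  then show False using assms by simp
qed


section \<open>Similarities and attractors inside an invariant set\<close>

lemma similarity_orthogonal_dist:
  assumes "orthogonal_transformation T" "0 \<le> r"
  shows "dist (similarity r T v x) (similarity r T v y) = r * dist x y"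
  using assms
  by (simp add: similarity_def dist_norm orthogonal_transformation
      linear_diff[symmetric] flip: scaleR_diff_right)

lemma continuous_on_similarity:
  assumes "orthogonal_transformation T"
  shows "continuous_on A (similarity r T v)"
  unfolding similarity_def[abs_def]
  using assms by (intro continuous_intros linear_continuous_on linear_conv_bounded_linear[THEN iffD1])
    (simp add: orthogonal_transformation)

text \<open>
  For \<open>F A = (\<Union>i. S\<^sub>i ` A)\<close>, the union \<open>K\<close> of all \<open>A \<subseteq> X\<close> with \<open>A \<subseteq> F A\<close> is the largest fixed point
  of \<open>F\<close> below \<open>X\<close> (Knaster-Tarski). The closure of \<open>K\<close> again satisfies the defining condition, so
  \<open>K\<close> is compact, and \<open>K\<close> contains the fixed point of \<open>S\<^sub>1\<close>, so it is not empty.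
\<close>

lemma ss_attractor_exists_within:
  fixes X :: "'a::euclidean_space set"
  assumes ifs: "ss_ifs m r T v" and X: "compact X" "X \<noteq> {}"
    and inv: "\<And>i. i \<in> {1..m} \<Longrightarrow> similarity (r i) (T i) (v i) ` X \<subseteq> X"
  shows "\<exists>K. ss_attractor m r T v K \<and> K \<subseteq> X"
proof -
  define F where "F A = (\<Union>i\<in>{1..m}. similarity (r i) (T i) (v i) ` A)" for A
  define K where "K = \<Union>{A. A \<subseteq> X \<and> A \<subseteq> F A}"
  have FX: "F A \<subseteq> X" if "A \<subseteq> X" for A using inv that unfolding F_def by blast
  have mono: "F A \<subseteq> F B" if "A \<subseteq> B" for A B using that unfolding F_def by blast
  have KX: "K \<subseteq> X" unfolding K_def by blast
  have sub: "A \<subseteq> K" if "A \<subseteq> X" "A \<subseteq> F A" for A using that unfolding K_def by blast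
  have "K \<subseteq> F K"
  proof
    fix x assume "x \<in> K"
    then obtain A where "x \<in> A" "A \<subseteq> X" "A \<subseteq> F A" unfolding K_def by blast
    then show "x \<in> F K" using mono[OF sub] by blast
  qed
  moreover have "F K \<subseteq> K"
    by (rule sub) (use FX[OF KX] mono[OF calculation] in auto)
  ultimately have fixK: "K = F K" by blast
  have clX: "closure K \<subseteq> X" using KX X by (simp add: closure_minimal compact_imp_closed)
  have "closure K \<subseteq> F (closure K)"
  proof (rule closure_minimal)
    show "K \<subseteq> F (closure K)" using fixK mono[OF closure_subset] by blast
    have "compact (closure K)"
      using clX X by (meson closed_closure compact_Int_closed compact_imp_bounded bounded_subset compact_closure KX)
    then have "compact (F (closure K))" unfolding F_def
      using ifs unfolding ss_ifs_def
      by (intro compact_UN compact_continuous_image continuous_on_similarity) auto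
    then show "closed (F (closure K))" by (rule compact_imp_closed)
  qed
  then have "closure K \<subseteq> K" using sub clX by blast
  then have "closed K" by (metis closure_subset closure_eq subset_antisym)
  then have compK: "compact K"
    using KX X compact_Int_closed[of X K] by (simp add: Int_absorb1)
  have "K \<noteq> {}"
  proof -
    have 1: "1 \<in> {1..m}" "0 < r 1" "r 1 < 1" "orthogonal_transformation (T 1)"
      using ifs unfolding ss_ifs_def by auto
    have "\<exists>!x\<in>X. similarity (r 1) (T 1) (v 1) x = x"
      using inv[OF 1(1)] 1 X
      by (intro Banach_fix[of X "r 1"]) (auto simp: similarity_orthogonal_dist compact_imp_complete)
    then obtain x where x: "x \<in> X" "similarity (r 1) (T 1) (v 1) x = x" by blast
    have "{x} \<subseteq> K"
    proof (rule sub)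
      show "{x} \<subseteq> F {x}" unfolding F_def using 1(1) x(2) by force
    qed (use x in auto)
    then show ?thesis by blast
  qed
  then have "ss_attractor m r T v K" using fixK compK unfolding ss_attractor_def F_def by blast
  then show ?thesis using KX by blast
qed


section \<open>Dimension of separated systems with a common ratio\<close>

lemma finite_positive_lower_bound:
  fixes f :: "'b \<Rightarrow> real"
  assumes "finite S" "\<And>x. x \<in> S \<Longrightarrow> 0 < f x"
  shows "\<exists>c>0. c \<le> 1 \<and> (\<forall>x\<in>S. c \<le> f x)"
proof (intro exI conjI ballI)
  have fin: "finite (insert 1 (f ` S))" using assms by auto
  show "0 < Min (insert 1 (f ` S))" using fin assms by (subst Min_gr_iff) auto
  show "Min (insert 1 (f ` S)) \<le> 1" using fin by (intro Min_le) auto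
  show "Min (insert 1 (f ` S)) \<le> f x" if "x \<in> S" for x using fin that by (intro Min_le) auto
qed

text \<open>
  Needed to pass from countable covers of a compact set to finite ones at arbitrarily small cost.
\<close>

lemma diam_pow_open_enlargement:
  fixes U :: "'a::metric_space set"
  assumes s: "0 < s" and U: "bounded U" and e: "0 < e"
  obtains V where "open V" "U \<subseteq> V" "bounded V" "diam_pow s V \<le> diam_pow s U + ennreal e"
proof (cases "U = {}")
  case True
  then show ?thesis using that[of "{}"] by (simp add: diam_pow_def)
next
  case False
  have "((\<lambda>h. (diameter U + 2 * h) powr s) \<longlongrightarrow> (diameter U + 2 * 0) powr s) (at_right 0)"
    using s diameter_ge_0[OF U]
    by (intro tendsto_powr2 tendsto_intros) (auto simp: eventually_at_filter)
  then have "\<forall>\<^sub>F h in at_right 0. (diameter U + 2 * h) powr s < diameter U powr s + e"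
    using e by (intro order_tendstoD) auto
  moreover have "\<forall>\<^sub>F h in at_right 0. (0::real) < h" by (simp add: eventually_at_filter)
  ultimately have "\<forall>\<^sub>F h in at_right 0. 0 < h \<and> (diameter U + 2 * h) powr s < diameter U powr s + e"
    by eventually_elim auto
  then obtain h where h: "0 < h" "(diameter U + 2 * h) powr s < diameter U powr s + e"
    using eventually_happens trivial_limit_at_right_real by (metis (mono_tags, lifting))
  define V where "V = (\<Union>x\<in>U. ball x h)"
  have d: "dist y z \<le> diameter U + 2 * h" if yz: "y \<in> V" "z \<in> V" for y z
  proof -
    obtain a b where "a \<in> U" "dist a y < h" "b \<in> U" "dist b z < h"
      using yz unfolding V_def by auto
    moreover have "dist a b \<le> diameter U" using calculation U by (intro diameter_bounded_bound)
    moreover have "dist y z \<le> dist a y + dist a b + dist b z"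
      using dist_triangle[of y z a] dist_triangle[of a z b] by (simp add: dist_commute)
    ultimately show ?thesis by simp
  qed
  have "bounded V" unfolding bounded_two_points using d by (intro exI[of _ "diameter U + 2 * h"]) auto
  moreover have "diameter V \<le> diameter U + 2 * h"
    using d h diameter_ge_0[OF U] by (intro diameter_leI) auto
  moreover have "diam_pow s V \<le> diam_pow s U + ennreal e"
  proof -
    have "diameter V powr s \<le> diameter U powr s + e"
      using h s calculation diameter_ge_0 powr_mono2[of s "diameter V" "diameter U + 2 * h"] by force
    then show ?thesis using s e False
      by (auto simp: diam_pow_def V_def[symmetric] ennreal_plus[symmetric] simp del: ennreal_plus
          intro!: ennreal_leI)
  qed
  moreover have "U \<subseteq> V" "open V" using h unfolding V_def by auto
  ultimately show ?thesis using that by blast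
qed

lemma diam_pow_pos_exponent: "0 < s \<Longrightarrow> diam_pow s U = ennreal (diameter U powr s)"
  by (simp add: diam_pow_def)

text \<open>
  The mass distribution principle for finite covers, without a measure. If every member of the
  cover is smaller than the gap \<open>\<eta>\<close>, it meets at most one piece \<open>f i ` K\<close>. The members that meet
  \<open>f i ` K\<close> pull back along \<open>f i\<close> to a cover of \<open>K\<close>, whose sum is at most \<open>\<rho> powr (-s)\<close> times
  theirs. By induction each of these sums is at least \<open>\<eta> powr s\<close>, so the original sum is at least
  \<open>card I * \<rho> powr s * \<eta> powr s \<ge> \<eta> powr s\<close>. The induction is on the number of members, which drops
  because at least two pieces have to be covered.
\<close>

lemma separated_self_similar_finite_cover:
  fixes f :: "'i \<Rightarrow> 'a::metric_space \<Rightarrow> 'a"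
  assumes I: "finite I" "2 \<le> card I" and \<rho>: "0 < \<rho>"
    and f: "\<And>i x y. i \<in> I \<Longrightarrow> dist (f i x) (f i y) = \<rho> * dist x y"
    and K: "K \<noteq> {}" "\<And>i. i \<in> I \<Longrightarrow> f i ` K \<subseteq> K"
    and gap: "\<And>i j x y. i \<in> I \<Longrightarrow> j \<in> I \<Longrightarrow> i \<noteq> j \<Longrightarrow> x \<in> f i ` K \<Longrightarrow> y \<in> f j ` K \<Longrightarrow> \<eta> \<le> dist x y"
    and s: "0 < s" "1 \<le> real (card I) * \<rho> powr s" and \<eta>: "0 < \<eta>"
    and F: "finite F" "\<And>U. U \<in> F \<Longrightarrow> bounded U" "K \<subseteq> \<Union>F"
  shows "\<eta> powr s \<le> (\<Sum>U\<in>F. diameter U powr s)"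
  using F
proof (induction "card F" arbitrary: F rule: less_induct)
  case less
  show ?case
  proof (cases "\<exists>U\<in>F. \<eta> \<le> diameter U")
    case True
    then obtain U where U: "U \<in> F" "\<eta> \<le> diameter U" by blast
    have "\<eta> powr s \<le> diameter U powr s" using U \<eta> s by (intro powr_mono2) auto
    also have "\<dots> \<le> (\<Sum>U\<in>F. diameter U powr s)" using U less.prems by (intro member_le_sum) auto
    finally show ?thesis .
  next
    case False
    define C where "C i = {U \<in> F. U \<inter> f i ` K \<noteq> {}}" for i
    have CF: "C i \<subseteq> F" for i by (auto simp: C_def)
    then have finC: "finite (C i)" for i using less.prems(1) finite_subset by blast
    \<comment> \<open>a set meeting two different pieces would have diameter at least \<open>\<eta>\<close>\<close>
    have disj: "C i \<inter> C j = {}" if ij: "i \<in> I" "j \<in> I" "i \<noteq> j" for i j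
    proof (rule ccontr)
      assume "C i \<inter> C j \<noteq> {}"
      then obtain U x y where U: "U \<in> F" "x \<in> U" "y \<in> U" "x \<in> f i ` K" "y \<in> f j ` K"
        by (auto simp: C_def)
      then have "dist x y \<le> diameter U" using less.prems(2) by (intro diameter_bounded_bound)
      moreover have "\<eta> \<le> dist x y" using gap[OF ij] U by blast
      ultimately show False using False U(1) by auto
    qed
    have nonempty: "C i \<noteq> {}" if i: "i \<in> I" for i
    proof -
      obtain x where "x \<in> K" using K by blast
      then have "f i x \<in> \<Union>F" using K(2)[OF i] less.prems(3) by blast
      then show ?thesis using \<open>x \<in> K\<close> by (auto simp: C_def)
    qed
    have piece: "\<rho> powr s * \<eta> powr s \<le> (\<Sum>U\<in>C i. diameter U powr s)" if i: "i \<in> I" for i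
    proof -
      define D where "D = (\<lambda>U. f i -` U) ` C i"
      have "\<not> I \<subseteq> {i}" using I card_mono[of "{i}" I] by auto
      then obtain j where j: "j \<in> I" "j \<noteq> i" by blast
      have "C i \<subset> F" using CF[of i] CF[of j] nonempty[OF j(1)] disj[OF i j(1)] j(2) by blast
      then have "card D < card F"
        unfolding D_def using card_image_le[OF finC] psubset_card_mono[OF less.prems(1)]
        by (metis le_less_trans)
      have pull: "bounded (f i -` U) \<and> diameter (f i -` U) \<le> diameter U / \<rho>" if "U \<in> C i" for U
      proof -
        have bU: "bounded U" using that less.prems(2) CF by blast
        have d: "dist x y \<le> diameter U / \<rho>" if "x \<in> f i -` U" "y \<in> f i -` U" for x y
        proof -
          have "\<rho> * dist x y \<le> diameter U"
            using diameter_bounded_bound[OF bU, of "f i x" "f i y"] that f[OF i] by auto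
          then show ?thesis using \<rho> by (simp add: field_simps)
        qed
        show ?thesis
        proof
          show "bounded (f i -` U)" unfolding bounded_two_points using d by blast
          show "diameter (f i -` U) \<le> diameter U / \<rho>"
            using d \<rho> diameter_ge_0[OF bU] by (intro diameter_leI) auto
        qed
      qed
      have "K \<subseteq> \<Union>D"
      proof
        fix x assume x: "x \<in> K"
        then have "f i x \<in> K" using K(2)[OF i] by blast
        then obtain U where "U \<in> F" "f i x \<in> U" using less.prems(3) by blast
        then show "x \<in> \<Union>D" using x by (auto simp: D_def C_def)
      qed
      moreover have "finite D" using finC by (auto simp: D_def)
      moreover have "bounded W" if "W \<in> D" for W using pull that by (auto simp: D_def)
      ultimately have "\<eta> powr s \<le> (\<Sum>W\<in>D. diameter W powr s)"
        using less.hyps[OF \<open>card D < card F\<close>] by blast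
      also have "\<dots> \<le> (\<Sum>U\<in>C i. diameter (f i -` U) powr s)"
        using sum_image_le[of "C i" "\<lambda>W. diameter W powr s" "\<lambda>U. f i -` U"] finC
        by (simp add: D_def comp_def)
      also have "\<dots> \<le> (\<Sum>U\<in>C i. (diameter U / \<rho>) powr s)"
        using pull s by (intro sum_mono powr_mono2) (auto intro: diameter_ge_0)
      also have "\<dots> = (\<Sum>U\<in>C i. diameter U powr s) / \<rho> powr s"
        unfolding sum_divide_distrib
        using \<rho> less.prems(2) CF by (intro sum.cong) (auto simp: powr_divide diameter_ge_0)
      finally show ?thesis using \<rho> by (simp add: field_simps)
    qed
    have "1 * \<eta> powr s \<le> real (card I) * \<rho> powr s * \<eta> powr s"
      using s by (intro mult_right_mono) auto
    also have "\<dots> = (\<Sum>i\<in>I. \<rho> powr s * \<eta> powr s)" by simp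
    also have "\<dots> \<le> (\<Sum>i\<in>I. \<Sum>U\<in>C i. diameter U powr s)" using piece by (intro sum_mono)
    also have "\<dots> = (\<Sum>U\<in>(\<Union>i\<in>I. C i). diameter U powr s)"
      using I finC disj by (intro sum.UNION_disjoint[symmetric]) auto
    also have "\<dots> \<le> (\<Sum>U\<in>F. diameter U powr s)"
      using less.prems(1) CF by (intro sum_mono2) auto
    finally show ?thesis by simp
  qed
qed

text \<open>
  Disjoint compact pieces have a positive mutual distance, and compactness reduces countable
  covers to the finite ones treated above.
\<close>

lemma separated_self_similar_measure_pos:
  fixes f :: "'i \<Rightarrow> 'a::heine_borel \<Rightarrow> 'a"
  assumes I: "finite I" "2 \<le> card I" and \<rho>: "0 < \<rho>"
    and f: "\<And>i x y. i \<in> I \<Longrightarrow> dist (f i x) (f i y) = \<rho> * dist x y"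
    and K: "K \<noteq> {}" "compact K" "\<And>i. i \<in> I \<Longrightarrow> f i ` K \<subseteq> K"
    and disj: "disjoint_family_on (\<lambda>i. f i ` K) I"
    and s: "0 < s" "1 \<le> real (card I) * \<rho> powr s"
  shows "hausdorff_measure s K \<noteq> 0"
proof -
  obtain \<eta> where \<eta>: "0 < \<eta>" and
    gap: "\<And>i j x y. i \<in> I \<Longrightarrow> j \<in> I \<Longrightarrow> i \<noteq> j \<Longrightarrow> x \<in> f i ` K \<Longrightarrow> y \<in> f j ` K \<Longrightarrow> \<eta> \<le> dist x y"
  proof -
    have comp: "compact (f i ` K)" if "i \<in> I" for i
    proof (rule compact_continuous_image)
      show "continuous_on K (f i)"
        unfolding continuous_on_iff f[OF that] using \<rho>
        by (metis divide_pos_pos mult.commute pos_less_divide_eq)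
    qed (rule K)
    have "\<forall>p\<in>I \<times> I. \<exists>\<eta>. \<eta> > 0 \<and> (fst p \<noteq> snd p \<longrightarrow>
        (\<forall>x\<in>f (fst p) ` K. \<forall>y\<in>f (snd p) ` K. \<eta> \<le> dist x y))"
    proof
      fix p assume p: "p \<in> I \<times> I"
      show "\<exists>\<eta>. \<eta> > 0 \<and> (fst p \<noteq> snd p \<longrightarrow>
        (\<forall>x\<in>f (fst p) ` K. \<forall>y\<in>f (snd p) ` K. \<eta> \<le> dist x y))"
      proof (cases "fst p = snd p")
        case True
        then show ?thesis by (intro exI[of _ 1]) simp
      next
        case False
        then have "f (fst p) ` K \<inter> f (snd p) ` K = {}"
          using disjoint_family_onD[OF disj, of "fst p" "snd p"] p by (simp add: mem_Times_iff)
        then obtain \<delta> where "\<delta> > 0" "\<forall>x\<in>f (fst p) ` K. \<forall>y\<in>f (snd p) ` K. \<delta> \<le> dist x y"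
          using separate_compact_closed[OF comp compact_imp_closed[OF comp], of "fst p" "snd p"] p
          by (metis mem_Times_iff)
        then show ?thesis by blast
      qed
    qed
    from bchoice[OF this] obtain e where e: "\<forall>p\<in>I \<times> I. e p > 0 \<and> (fst p \<noteq> snd p \<longrightarrow>
        (\<forall>x\<in>f (fst p) ` K. \<forall>y\<in>f (snd p) ` K. e p \<le> dist x y))" ..
    have "\<exists>c>0. c \<le> 1 \<and> (\<forall>p\<in>I \<times> I. c \<le> e p)"
      by (rule finite_positive_lower_bound) (use I e in auto)
    then obtain \<eta> where "0 < \<eta>" and \<eta>: "\<And>p. p \<in> I \<times> I \<Longrightarrow> \<eta> \<le> e p" by blast
    have "\<eta> \<le> dist x y"
      if "i \<in> I" "j \<in> I" "i \<noteq> j" "x \<in> f i ` K" "y \<in> f j ` K" for i j x y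
    proof -
      have "\<eta> \<le> e (i, j)" using \<eta> that by simp
      also have "\<dots> \<le> dist x y" using e[rule_format, of "(i, j)"] that by auto
      finally show ?thesis .
    qed
    with \<open>0 < \<eta>\<close> show ?thesis by (rule that)
  qed
  have "ennreal (\<eta> powr s) \<le> (\<Sum>n. diam_pow s (U n))"
    if U: "K \<subseteq> (\<Union>n. U n)" "\<And>n. bounded (U n)" for U :: "nat \<Rightarrow> 'a set"
  proof (rule ennreal_le_epsilon)
    fix e :: real assume e: "0 < e"
    have "\<forall>n. \<exists>V. open V \<and> U n \<subseteq> V \<and> bounded V \<and>
        diam_pow s V \<le> diam_pow s (U n) + ennreal (e * (1/2) ^ Suc n)"
    proof
      fix n
      have "0 < e * (1/2) ^ Suc n" using e by simp
      from diam_pow_open_enlargement[OF s(1) U(2) this, of n]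
      show "\<exists>V. open V \<and> U n \<subseteq> V \<and> bounded V \<and>
        diam_pow s V \<le> diam_pow s (U n) + ennreal (e * (1/2) ^ Suc n)" by metis
    qed
    from choice[OF this] obtain V where V': "\<forall>n. open (V n) \<and> U n \<subseteq> V n \<and> bounded (V n) \<and>
        diam_pow s (V n) \<le> diam_pow s (U n) + ennreal (e * (1/2) ^ Suc n)" ..
    then have V: "\<And>n. open (V n)" "\<And>n. U n \<subseteq> V n" "\<And>n. bounded (V n)"
      "\<And>n. diam_pow s (V n) \<le> diam_pow s (U n) + ennreal (e * (1/2) ^ Suc n)" by simp_all
    have "(\<Union>n. U n) \<subseteq> (\<Union>n. V n)" using V(2) by (intro UN_mono) auto
    with U(1) have "K \<subseteq> (\<Union>n. V n)" by (rule order_trans)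
    then obtain N where N: "finite N" "K \<subseteq> (\<Union>n\<in>N. V n)"
      by (rule compactE_image[OF K(2) V(1)])
    have "\<eta> powr s \<le> (\<Sum>W\<in>V ` N. diameter W powr s)"
      by (rule separated_self_similar_finite_cover[OF I \<rho> f K(1,3) gap s \<eta>]) (use N V in auto)
    also have "\<dots> \<le> (\<Sum>n\<in>N. diameter (V n) powr s)"
      using sum_image_le[OF N(1), of "\<lambda>W. diameter W powr s" V] by (simp add: comp_def)
    finally have "ennreal (\<eta> powr s) \<le> (\<Sum>n\<in>N. diam_pow s (V n))"
      by (simp add: diam_pow_pos_exponent s ennreal_leI)
    also have "\<dots> \<le> (\<Sum>n\<in>N. diam_pow s (U n) + ennreal (e * (1/2) ^ Suc n))"
      using V(4) by (intro sum_mono)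
    also have "\<dots> \<le> (\<Sum>n. diam_pow s (U n) + ennreal (e * (1/2) ^ Suc n))"
      by (rule sum_le_suminf) (use N in auto)
    also have "\<dots> = (\<Sum>n. diam_pow s (U n)) + (\<Sum>n. ennreal (e * (1/2) ^ Suc n))"
      by (rule suminf_add[symmetric]) auto
    also have "(\<Sum>n. ennreal (e * (1/2) ^ Suc n)) = ennreal e"
      using sums_mult[OF power_half_series, of e] e by (intro suminf_ennreal_eq) auto
    finally show "ennreal (\<eta> powr s) \<le> (\<Sum>n. diam_pow s (U n)) + ennreal e" .
  qed
  then have "ennreal (\<eta> powr s) \<le> hausdorff_premeasure s 1 K"
    unfolding hausdorff_premeasure_def by (intro INF_greatest) auto
  also have "\<dots> \<le> hausdorff_measure s K"
    unfolding hausdorff_measure_def by (intro SUP_upper) auto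
  finally show ?thesis using \<eta> by auto
qed

text \<open>
  The exponent \<open>0\<close> needs its own argument: nonempty sets of diameter \<open>0\<close> count as
  \<open>1\<close> in \<open>diam_pow 0\<close>, while \<open>0 powr 0 = 0\<close>.
\<close>

lemma hausdorff_measure_0_nonempty:
  assumes "A \<noteq> {}"
  shows "hausdorff_measure 0 A \<noteq> 0"
proof -
  have "1 \<le> (\<Sum>n. diam_pow 0 (U n))" if U: "A \<subseteq> (\<Union>n. U n)" for U
  proof -
    obtain n where "U n \<noteq> {}" using U assms by blast
    then have "1 = (\<Sum>k\<in>{n}. diam_pow 0 (U k))" by (simp add: diam_pow_def)
    also have "\<dots> \<le> (\<Sum>n. diam_pow 0 (U n))" by (rule sum_le_suminf) auto
    finally show ?thesis .
  qed
  then have "1 \<le> hausdorff_premeasure 0 1 A"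
    unfolding hausdorff_premeasure_def by (intro INF_greatest) auto
  also have "\<dots> \<le> hausdorff_measure 0 A"
    unfolding hausdorff_measure_def by (intro SUP_upper) auto
  finally show ?thesis by auto
qed

text \<open>
  The condition \<open>1 \<le> m * \<rho> powr s\<close> says that \<open>s\<close> is at most the similarity dimension. It passes to
  every exponent \<open>\<sigma> < s\<close> because \<open>\<rho> < 1\<close>, and then the \<open>\<sigma>\<close>-dimensional measure is positive.
\<close>

lemma strong_separation_hausdorff_dim_ge:
  assumes ifs: "ss_ifs m (\<lambda>_. \<rho>) T v" and att: "ss_attractor m (\<lambda>_. \<rho>) T v K"
    and sep: "strong_separation m (\<lambda>_. \<rho>) T v K"
    and s: "0 < s" "1 \<le> real m * \<rho> powr s"
  shows "ereal s \<le> hausdorff_dim K"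
  unfolding hausdorff_dim_def
proof (rule INF_greatest, rule ccontr)
  fix \<sigma> assume "\<sigma> \<in> {s. 0 \<le> s \<and> hausdorff_measure s K = 0}" and "\<not> ereal s \<le> ereal \<sigma>"
  then have \<sigma>: "0 \<le> \<sigma>" "hausdorff_measure \<sigma> K = 0" "\<sigma> < s" by auto
  have m: "1 \<le> m" and \<rho>: "0 < \<rho>" "\<rho> < 1" and T: "\<And>i. i \<in> {1..m} \<Longrightarrow> orthogonal_transformation (T i)"
    using ifs by (auto simp: ss_ifs_def)
  have K: "K \<noteq> {}" "compact K" "K = (\<Union>i\<in>{1..m}. similarity \<rho> (T i) (v i) ` K)"
    using att by (auto simp: ss_attractor_def)
  have "\<sigma> > 0" using hausdorff_measure_0_nonempty[OF K(1)] \<sigma> by (cases "\<sigma> = 0") auto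
  have "\<rho> powr s < 1" using powr_less_mono2[of s \<rho> 1] \<rho> s by simp
  then have "m \<noteq> 1" using s by auto
  then have m2: "2 \<le> m" using m by simp
  have "\<rho> powr s \<le> \<rho> powr \<sigma>" using \<rho> \<sigma> by (intro powr_mono') auto
  then have "1 \<le> real m * \<rho> powr \<sigma>" using s(2) mult_left_mono[of "\<rho> powr s" "\<rho> powr \<sigma>" "real m"] by simp
  moreover have "dist (similarity \<rho> (T i) (v i) x) (similarity \<rho> (T i) (v i) y) = \<rho> * dist x y"
    if "i \<in> {1..m}" for i x y using similarity_orthogonal_dist[OF T[OF that]] \<rho> by simp
  moreover have "similarity \<rho> (T i) (v i) ` K \<subseteq> K" if "i \<in> {1..m}" for i
    using K(3) that by blast
  ultimately have "hausdorff_measure \<sigma> K \<noteq> 0"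
    using K(1,2) m2 \<rho> \<open>\<sigma> > 0\<close> sep unfolding strong_separation_def
    by (intro separated_self_similar_measure_pos[where I = "{1..m}" and \<rho> = \<rho>
          and f = "\<lambda>i. similarity \<rho> (T i) (v i)"]) auto
  then show False using \<sigma> by simp
qed


section \<open>Compositions of similarities along walks\<close>

definition walk_ratio :: "('e \<Rightarrow> real) \<Rightarrow> 'e list \<Rightarrow> real" where
  "walk_ratio r p = prod_list (map r p)"

definition walk_map ::
  "('e \<Rightarrow> real) \<Rightarrow> ('e \<Rightarrow> 'a \<Rightarrow> 'a) \<Rightarrow> ('e \<Rightarrow> 'a::euclidean_space) \<Rightarrow> 'e list \<Rightarrow> 'a \<Rightarrow> 'a" where
  "walk_map r T v p = foldr (\<lambda>e f. similarity (r e) (T e) (v e) \<circ> f) p id"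

lemma walk_ratio_simps [simp]:
  "walk_ratio r [] = 1" "walk_ratio r (e # p) = r e * walk_ratio r p"
  "walk_ratio r (p @ q) = walk_ratio r p * walk_ratio r q"
  by (simp_all add: walk_ratio_def)

lemma walk_map_simps [simp]:
  "walk_map r T v [] x = x"
  "walk_map r T v (e # p) x = similarity (r e) (T e) (v e) (walk_map r T v p x)"
  by (simp_all add: walk_map_def)

lemma walk_map_append [simp]: "walk_map r T v (p @ q) x = walk_map r T v p (walk_map r T v q x)"
  by (induction p) simp_all

lemma path_map_simps [simp]:
  "path_map T [] = id" "path_map T (e # p) = T e \<circ> path_map T p"
  by (simp_all add: path_map_def)

lemma path_map_append [simp]: "path_map T (p @ q) = path_map T p \<circ> path_map T q"
  by (induction p) (simp_all add: comp_assoc)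

lemma walk_ratio_bounds:
  assumes "\<And>e. e \<in> set p \<Longrightarrow> 0 < r e \<and> r e \<le> b"
  shows "0 < walk_ratio r p" "walk_ratio r p \<le> b ^ length p"
proof -
  have "0 < walk_ratio r p \<and> walk_ratio r p \<le> b ^ length p"
    using assms
  proof (induction p)
    case (Cons e p)
    then have "0 < r e" "r e \<le> b" "0 < walk_ratio r p" "walk_ratio r p \<le> b ^ length p" by auto
    then show ?case by (auto intro!: mult_mono)
  qed simp
  then show "0 < walk_ratio r p" "walk_ratio r p \<le> b ^ length p" by auto
qed

lemma path_map_orthogonal:
  assumes "\<And>e. e \<in> set p \<Longrightarrow> orthogonal_transformation (T e)"
  shows "orthogonal_transformation (path_map T p)"
  using assms
proof (induction p)
  case Nil
  then show ?case by (simp add: id_def)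
next
  case (Cons e p)
  then show ?case
    unfolding path_map_simps by (intro orthogonal_transformation_compose) auto
qed

lemma walk_map_eq_similarity:
  assumes "\<And>e. e \<in> set p \<Longrightarrow> orthogonal_transformation (T e)"
  shows "walk_map r T v p = similarity (walk_ratio r p) (path_map T p) (walk_map r T v p 0)"
proof
  fix x show "walk_map r T v p x = similarity (walk_ratio r p) (path_map T p) (walk_map r T v p 0) x"
    using assms
  proof (induction p)
    case Nil
    then show ?case by (simp add: similarity_def)
  next
    case (Cons e p)
    have lin: "linear (T e)" using Cons.prems by (simp add: orthogonal_transformation)
    have IH: "walk_map r T v p x = walk_ratio r p *\<^sub>R path_map T p x + walk_map r T v p 0"
      using Cons by (simp add: similarity_def)
    show ?case
      by (simp add: similarity_def IH linear_add[OF lin] linear_scale[OF lin] scaleR_add_right)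
  qed
qed

text \<open>
  Ratios of walks are products in a commutative monoid with \<open>card A\<close> generators, so a ratio depends
  only on how often each edge occurs. There are exponentially many walks of length at most \<open>n\<close>, but
  only polynomially many ratios.
\<close>

lemma card_walk_ratios_le:
  assumes A: "finite A"
  shows "finite {walk_ratio r p |p. set p \<subseteq> A \<and> length p \<le> n}"
    and "card {walk_ratio r p |p. set p \<subseteq> A \<and> length p \<le> n} \<le> (n + 1) ^ card A"
proof -
  have ratio: "walk_ratio r p = (\<Prod>e\<in>A. r e ^ count_list p e)" if "set p \<subseteq> A" for p
    using that
  proof (induction p)
    case (Cons e p)
    have "(\<Prod>x\<in>A. r x ^ count_list (e # p) x)
        = (\<Prod>x\<in>A. (if x = e then r x else 1) * r x ^ count_list p x)"
      by (intro prod.cong) auto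
    also have "\<dots> = r e * (\<Prod>x\<in>A. r x ^ count_list p x)"
      using Cons.prems A by (simp add: prod.distrib prod.delta)
    finally show ?case using Cons by simp
  qed simp
  let ?X = "PiE A (\<lambda>_. {..n})"
  have sub: "{walk_ratio r p |p. set p \<subseteq> A \<and> length p \<le> n} \<subseteq> (\<lambda>c. \<Prod>e\<in>A. r e ^ c e) ` ?X"
  proof clarify
    fix p assume p: "set p \<subseteq> A" "length p \<le> n"
    have "walk_ratio r p = (\<Prod>e\<in>A. r e ^ restrict (count_list p) A e)"
      using ratio[OF p(1)] by simp
    moreover have "restrict (count_list p) A \<in> ?X"
      using count_le_length[of p] p(2) by (auto intro: order_trans)
    ultimately show "walk_ratio r p \<in> (\<lambda>c. \<Prod>e\<in>A. r e ^ c e) ` ?X" by (rule image_eqI)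
  qed
  have fin: "finite ?X" using A by (intro finite_PiE) auto
  show "finite {walk_ratio r p |p. set p \<subseteq> A \<and> length p \<le> n}"
    using sub fin finite_subset by blast
  have "card {walk_ratio r p |p. set p \<subseteq> A \<and> length p \<le> n} \<le> card ?X"
    using surj_card_le[OF fin sub] .
  also have "\<dots> = (n + 1) ^ card A" using A by (simp add: card_PiE)
  finally show "card {walk_ratio r p |p. set p \<subseteq> A \<and> length p \<le> n} \<le> (n + 1) ^ card A" .
qed


section \<open>Groups generated by finite closed sets\<close>

text \<open>
  In a finite set closed under multiplication, multiplication by an element is injective and hence
  surjective, which produces the unit and inverses. So inverses add nothing to a finite group.
\<close>

lemma (in group) generate_finite_mult_closed:
  assumes M: "finite M" "M \<noteq> {}" "M \<subseteq> carrier G"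
    and closed: "\<And>x y. x \<in> M \<Longrightarrow> y \<in> M \<Longrightarrow> x \<otimes> y \<in> M"
  shows "generate G M = M"
proof -
  have MC: "\<And>x. x \<in> M \<Longrightarrow> x \<in> carrier G" using M(3) by blast
  have solve: "\<exists>x\<in>M. g \<otimes> x = h" if g: "g \<in> M" "h \<in> M" for g h
  proof -
    have "inj_on (\<lambda>x. g \<otimes> x) M"
      using g by (intro inj_onI) (simp add: MC)
    then have "(\<lambda>x. g \<otimes> x) ` M = M"
      using M(1) closed[OF g(1)] by (intro endo_inj_surj) auto
    with g(2) have "h \<in> (\<lambda>x. g \<otimes> x) ` M" by (simp only:)
    then show ?thesis by auto
  qed
  have one: "\<one> \<in> M"
  proof -
    obtain g where g: "g \<in> M" using M(2) by blast
    from solve[OF g g] obtain x where "x \<in> M" "g \<otimes> x = g" ..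
    then show ?thesis using MC g by auto
  qed
  have inv: "inv g \<in> M" if "g \<in> M" for g
  proof -
    from solve[OF that one] obtain x where x: "x \<in> M" "g \<otimes> x = \<one>" ..
    then have "inv g = x" using MC that by (metis inv_comm inv_equality)
    then show ?thesis using x by simp
  qed
  have "subgroup M G"
    using M one inv closed by (intro subgroupI) auto
  then show ?thesis
    using generate_subgroup_incl[of M M] generate.incl[of _ M G] by blast
qed


section \<open>Strongly connected graph directed systems\<close>

lemma polynomial_below_exponential:
  fixes C \<gamma> :: real
  assumes "0 < \<gamma>" "\<gamma> < 1" "0 < C"
  shows "\<forall>\<^sub>F k in sequentially. (real k + a) ^ E * \<gamma> ^ k < C"
proof -
  have "((\<lambda>k::nat. (real k + a) ^ E * \<gamma> ^ k) \<longlongrightarrow> 0) sequentially"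
    using assms by real_asymp
  then show ?thesis using assms(3) by (rule order_tendstoD)
qed

locale strongly_connected_gd_ifs = fin_digraph G
  for G :: "('v, 'e) pre_digraph" +
  fixes r :: "'e \<Rightarrow> real" and T :: "'e \<Rightarrow> 'a \<Rightarrow> 'a::euclidean_space" and v :: "'e \<Rightarrow> 'a"
    and K :: "'v \<Rightarrow> 'a set"
  assumes gd: "gd_ifs G r T v"
    and conn: "strongly_connected G"
    and attractor: "gd_attractor G r T v K"
begin

lemma edge_ratio: "e \<in> arcs G \<Longrightarrow> 0 < r e" "e \<in> arcs G \<Longrightarrow> r e < 1"
  and edge_orthogonal: "e \<in> arcs G \<Longrightarrow> orthogonal_transformation (T e)"
  using gd unfolding gd_ifs_def by blast+

lemma edge_ratio_uniformly_below_1: "\<exists>b>0. b < 1 \<and> (\<forall>e\<in>arcs G. r e \<le> b)"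
proof -
  have "\<exists>b>0. b \<le> 1 \<and> (\<forall>e\<in>arcs G. b \<le> 1 - r e)"
    by (rule finite_positive_lower_bound) (simp_all add: edge_ratio)
  then obtain b where "0 < b" "\<forall>e\<in>arcs G. b \<le> 1 - r e" by auto
  then show ?thesis by (intro exI[of _ "max (1/2) (1 - b)"]) (auto simp: le_max_iff_disj algebra_simps)
qed

lemma K_nonempty: "i \<in> verts G \<Longrightarrow> K i \<noteq> {}"
  and K_compact: "i \<in> verts G \<Longrightarrow> compact (K i)"
  using attractor unfolding gd_attractor_def by blast+

lemma K_unfold:
  assumes "i \<in> verts G"
  shows "K i = (\<Union>e\<in>out_arcs G i. similarity (r e) (T e) (v e) ` K (head G e))"
proof -
  have "K i = (\<Union>j\<in>verts G. \<Union>e\<in>edges_between G i j. similarity (r e) (T e) (v e) ` K j)"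
    using attractor assms unfolding gd_attractor_def by blast
  also have "\<dots> = (\<Union>e\<in>out_arcs G i. similarity (r e) (T e) (v e) ` K (head G e))"
    unfolding edges_between_def using assms by fastforce
  finally show ?thesis .
qed

lemma awalk_set: "awalk i p k \<Longrightarrow> set p \<subseteq> arcs G"
  by (auto simp: awalk_def)

lemma walk_map_is_similarity:
  assumes "awalk i p k"
  shows "walk_map r T v p = similarity (walk_ratio r p) (path_map T p) (walk_map r T v p 0)"
    and "orthogonal_transformation (path_map T p)"
  using awalk_set[OF assms] edge_orthogonal
  by (auto intro!: walk_map_eq_similarity path_map_orthogonal)

lemma walk_ratio_pos: "awalk i p k \<Longrightarrow> 0 < walk_ratio r p"
  using awalk_set edge_ratio by (intro walk_ratio_bounds(1)[of p r 1]) force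

text \<open>
  Consequently a cycle at \<open>j\<close> is a similarity that maps \<open>K j\<close> into itself.
\<close>

lemma walk_map_image_subset:
  assumes "awalk i p k"
  shows "walk_map r T v p ` K k \<subseteq> K i"
  using assms
proof (induction p arbitrary: i)
  case Nil
  then show ?case by (auto simp: awalk_Nil_iff)
next
  case (Cons e p)
  then have e: "e \<in> arcs G" "tail G e = i" "awalk (head G e) p k" by (auto simp: awalk_Cons_iff)
  then have i: "i \<in> verts G" by auto
  have "walk_map r T v (e # p) ` K k = similarity (r e) (T e) (v e) ` (walk_map r T v p ` K k)"
    by (simp add: image_image)
  also have "\<dots> \<subseteq> similarity (r e) (T e) (v e) ` K (head G e)"
    using Cons.IH[OF e(3)] by (rule image_mono)
  also have "\<dots> \<subseteq> K i" using e unfolding K_unfold[OF i] by auto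
  finally show ?case .
qed

text \<open>
  Follow an address of \<open>x\<close> until the product of the ratios first drops to \<open>\<delta>\<close> or below. The last
  factor is at least \<open>a\<close>, so the product stays above \<open>a * \<delta>\<close>. The induction on \<open>n\<close> bounds the
  length of the address that is needed.
\<close>

lemma walk_of_scale_at_point:
  assumes a: "0 < a" "\<And>e. e \<in> arcs G \<Longrightarrow> a \<le> r e" and b: "\<And>e. e \<in> arcs G \<Longrightarrow> r e \<le> b" "a \<le> 1" "0 < b"
    and \<delta>: "b ^ n \<le> \<delta>" "\<delta> \<le> 1" and x: "i \<in> verts G" "x \<in> K i"
  shows "\<exists>p k. awalk i p k \<and> x \<in> walk_map r T v p ` K k \<and> a * \<delta> \<le> walk_ratio r p \<and> walk_ratio r p \<le> \<delta>"
  using \<delta> x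
proof (induction n arbitrary: \<delta> i x)
  case 0
  then have "\<delta> = 1" by simp
  then show ?case using 0 b by (intro exI[of _ "[]"] exI[of _ i]) (auto simp: awalk_Nil_iff)
next
  case (Suc n)
  obtain e y where e: "e \<in> arcs G" "tail G e = i" and y: "y \<in> K (head G e)"
    and x: "x = similarity (r e) (T e) (v e) y"
    using Suc.prems(4) unfolding K_unfold[OF Suc.prems(3)] by auto
  have re: "0 < r e" "r e < 1" "a \<le> r e" "r e \<le> b" using e a b edge_ratio by auto
  have hd: "head G e \<in> verts G" using e by auto
  show ?case
  proof (cases "r e \<le> \<delta>")
    case True
    have "0 < \<delta>" using True re by linarith
    then have "a * \<delta> \<le> r e"
      using re a Suc.prems(2) mult_mono[of a "r e" \<delta> 1] by simp
    moreover have "awalk i [e] (head G e)" using e hd by (simp add: awalk_Cons_iff awalk_Nil_iff)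
    moreover have "x \<in> walk_map r T v [e] ` K (head G e)" using x y by simp
    ultimately show ?thesis using True
      by (intro exI[of _ "[e]"] exI[of _ "head G e"]) simp
  next
    case False
    have "b ^ n \<le> \<delta> / r e"
    proof -
      have "r e * b ^ n \<le> b * b ^ n" using re b by (intro mult_right_mono) auto
      also have "\<dots> \<le> \<delta>" using Suc.prems(1) by simp
      finally show ?thesis using re by (simp add: field_simps)
    qed
    moreover have "\<delta> / r e \<le> 1" using False re by simp
    ultimately obtain p k where p: "awalk (head G e) p k" "y \<in> walk_map r T v p ` K k"
      "a * (\<delta> / r e) \<le> walk_ratio r p" "walk_ratio r p \<le> \<delta> / r e"
      using Suc.IH[of "\<delta> / r e" "head G e" y] hd y by blast
    have "awalk i (e # p) k" using p(1) e by (simp add: awalk_Cons_iff)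
    moreover have "x \<in> walk_map r T v (e # p) ` K k" using p(2) x by auto
    moreover have "a * \<delta> \<le> walk_ratio r (e # p)" "walk_ratio r (e # p) \<le> \<delta>"
      using p(3,4) re by (simp_all add: field_simps)
    ultimately show ?thesis by blast
  qed
qed

lemma directed_cycle_exists:
  assumes j: "j \<in> verts G"
  shows "directed_cycles G j \<noteq> {}"
proof -
  obtain e where e: "e \<in> arcs G" "tail G e = j"
    using gd j unfolding gd_ifs_def by fastforce
  then obtain p where "awalk (head G e) p j"
    using conn j unfolding strongly_connected_def by (metis head_in_verts reachable_awalk)
  then have "awalk j (e # p) j" using e by (simp add: awalk_Cons_iff)
  then have "e # p \<in> directed_cycles G j" unfolding directed_cycles_def by simp
  then show ?thesis by blast
qed

lemma path_map_cycle_in_orthogonal_group: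
  "p \<in> directed_cycles G j \<Longrightarrow> path_map T p \<in> carrier orthogonal_group"
  by (auto simp: directed_cycles_def orthogonal_group_def intro: walk_map_is_similarity(2))

lemma transformation_group_is_subgroup: "subgroup (transformation_group G T j) orthogonal_group"
  unfolding transformation_group_def using path_map_cycle_in_orthogonal_group
  by (intro group.generate_is_subgroup[OF group_orthogonal_group]) blast

text \<open>
  Cycles at \<open>j\<close> can be concatenated, so their linear parts form a closed set. When the group is
  finite, this set is already the group: each of its elements is the linear part of a single cycle.
\<close>

lemma finite_transformation_group_eq:
  assumes j: "j \<in> verts G" and fin: "finite (transformation_group G T j)"
  shows "transformation_group G T j = path_map T ` directed_cycles G j"
  unfolding transformation_group_def
proof (rule group.generate_finite_mult_closed[OF group_orthogonal_group])
  show "finite (path_map T ` directed_cycles G j)"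
    using fin unfolding transformation_group_def
    by (rule finite_subset[rotated]) (auto intro: generate.incl)
  show "path_map T ` directed_cycles G j \<noteq> {}" using directed_cycle_exists[OF j] by simp
  show "path_map T ` directed_cycles G j \<subseteq> carrier orthogonal_group"
    using path_map_cycle_in_orthogonal_group by blast
  fix x y assume "x \<in> path_map T ` directed_cycles G j" "y \<in> path_map T ` directed_cycles G j"
  then obtain p q where p: "p \<in> directed_cycles G j" "x = path_map T p"
    and q: "q \<in> directed_cycles G j" "y = path_map T q" by blast
  have "p @ q \<in> directed_cycles G j"
    using p(1) q(1) unfolding directed_cycles_def by (auto intro: awalk_appendI)
  moreover have "x \<otimes>\<^bsub>orthogonal_group\<^esub> y = path_map T (p @ q)"
    using p q by (simp add: orthogonal_group_def)
  ultimately show "x \<otimes>\<^bsub>orthogonal_group\<^esub> y \<in> path_map T ` directed_cycles G j" by blast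
qed

text \<open>
  Take a walk \<open>p\<close> of scale \<open>\<delta>\<close> whose cylinder contains \<open>x\<close>, return from its end to \<open>j\<close>, and append
  a cycle that corrects the linear part to \<open>Q\<close>. The return walks are indexed by the vertices and the
  corrections by the group, so there are finitely many of both and they change the ratio by a
  bounded factor \<open>\<kappa>\<close> only. The image of \<open>K j\<close> stays in the cylinder of \<open>p\<close> and hence near \<open>x\<close>.
\<close>

lemma cycle_with_rotation_at_point:
  assumes j: "j \<in> verts G" and fin: "finite (transformation_group G T j)"
    and Q: "Q \<in> transformation_group G T j"
  obtains \<kappa> D where "0 < \<kappa>" "0 < D"
    "\<And>x \<delta>. x \<in> K j \<Longrightarrow> 0 < \<delta> \<Longrightarrow> \<delta> \<le> 1 \<Longrightarrow>
       \<exists>w. awalk j w j \<and> path_map T w = Q \<and> \<kappa> * \<delta> \<le> walk_ratio r w \<and> walk_ratio r w \<le> \<delta> \<and>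
         (\<forall>y\<in>K j. dist x (walk_map r T v w y) \<le> D * \<delta>)"
proof -
  let ?O = "orthogonal_group :: ('a \<Rightarrow> 'a) monoid" and ?\<T> = "transformation_group G T j"
  interpret O: group ?O by (rule group_orthogonal_group)
  have sub: "subgroup ?\<T> ?O" by (rule transformation_group_is_subgroup)
  have cycles: "?\<T> = path_map T ` directed_cycles G j" by (rule finite_transformation_group_eq[OF j fin])
  have "\<forall>k\<in>verts G. \<exists>p. awalk k p j"
    using conn j unfolding strongly_connected_def by (simp add: reachable_awalk)
  from bchoice[OF this] obtain ret where "\<forall>k\<in>verts G. awalk k (ret k) j" ..
  then have ret: "\<And>k. k \<in> verts G \<Longrightarrow> awalk k (ret k) j" by simp
  have "\<forall>g\<in>?\<T>. \<exists>c. awalk j c j \<and> path_map T c = g"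
    unfolding cycles by (auto simp: directed_cycles_def)
  from bchoice[OF this] obtain corr where
    "\<forall>g\<in>?\<T>. awalk j (corr g) j \<and> path_map T (corr g) = g" ..
  then have corr: "\<And>g. g \<in> ?\<T> \<Longrightarrow> awalk j (corr g) j \<and> path_map T (corr g) = g" by simp
  have "\<exists>a>0. a \<le> 1 \<and> (\<forall>e\<in>arcs G. a \<le> r e)"
    by (rule finite_positive_lower_bound) (simp_all add: edge_ratio)
  then obtain a where a: "0 < a" "a \<le> 1" "\<And>e. e \<in> arcs G \<Longrightarrow> a \<le> r e" by auto
  obtain b where b: "0 < b" "b < 1" "\<And>e. e \<in> arcs G \<Longrightarrow> r e \<le> b"
    using edge_ratio_uniformly_below_1 by auto
  have "\<exists>\<mu>>0. \<mu> \<le> 1 \<and> (\<forall>k\<in>verts G. \<mu> \<le> walk_ratio r (ret k))"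
    by (rule finite_positive_lower_bound) (auto intro: walk_ratio_pos ret)
  then obtain \<mu> where \<mu>: "0 < \<mu>" "\<And>k. k \<in> verts G \<Longrightarrow> \<mu> \<le> walk_ratio r (ret k)" by auto
  have "\<exists>\<nu>>0. \<nu> \<le> 1 \<and> (\<forall>g\<in>?\<T>. \<nu> \<le> walk_ratio r (corr g))"
    using fin by (rule finite_positive_lower_bound) (use corr walk_ratio_pos in blast)
  then obtain \<nu> where \<nu>: "0 < \<nu>" "\<And>g. g \<in> ?\<T> \<Longrightarrow> \<nu> \<le> walk_ratio r (corr g)" by auto
  \<comment> \<open>a common bound for the diameters; the summand 1 makes it positive\<close>
  define D where "D = 1 + (\<Sum>k\<in>verts G. diameter (K k))"
  have diam: "0 \<le> diameter (K k)" if "k \<in> verts G" for k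
    using K_compact[OF that] by (intro diameter_ge_0 compact_imp_bounded)
  have D: "0 < D" "\<And>k. k \<in> verts G \<Longrightarrow> diameter (K k) \<le> D"
  proof -
    have "0 \<le> (\<Sum>k\<in>verts G. diameter (K k))" using diam by (rule sum_nonneg)
    then show "0 < D" by (simp add: D_def)
    show "diameter (K k) \<le> D" if "k \<in> verts G" for k
      using member_le_sum[OF that, of "\<lambda>k. diameter (K k)"] diam by (simp add: D_def)
  qed
  show ?thesis
  proof
    show "0 < a * \<mu> * \<nu>" "0 < D" using a \<mu> \<nu> D by simp_all
    fix x \<delta> assume x: "x \<in> K j" and \<delta>: "0 < \<delta>" "\<delta> \<le> (1::real)"
    obtain n where "b ^ n < \<delta>" using real_arch_pow_inv[OF \<delta>(1) b(2)] by blast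
    then obtain p k where p: "awalk j p k" "x \<in> walk_map r T v p ` K k"
      "a * \<delta> \<le> walk_ratio r p" "walk_ratio r p \<le> \<delta>"
      using walk_of_scale_at_point[OF a(1,3) b(3) a(2) b(1) _ \<delta>(2) j x, of n] by auto
    have k: "k \<in> verts G" using p(1) by (rule awalk_last_in_verts)
    define h where "h = path_map T (p @ ret k)"
    \<comment> \<open>\<open>h\<close> is what the closed walk contributes so far, \<open>g\<close> is the correction to \<open>Q\<close>\<close>
    define g where "g = inv\<^bsub>?O\<^esub> h \<otimes>\<^bsub>?O\<^esub> Q"
    have loop: "awalk j (p @ ret k) j" using p(1) ret[OF k] by (rule awalk_appendI)
    have h: "h \<in> ?\<T>"
    proof (cases "p @ ret k = []")
      case True
      then have "h = \<one>\<^bsub>?O\<^esub>" by (simp add: h_def orthogonal_group_def)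
      then show ?thesis using subgroup.one_closed[OF sub] by simp
    next
      case False
      then show ?thesis unfolding cycles h_def directed_cycles_def using loop by blast
    qed
    have g: "g \<in> ?\<T>"
      unfolding g_def using h Q sub by (simp add: subgroup.m_inv_closed subgroup.m_closed)
    have carr: "h \<in> carrier ?O" "Q \<in> carrier ?O" using h Q subgroup.mem_carrier[OF sub] by auto
    have "h \<otimes>\<^bsub>?O\<^esub> g = Q"
      unfolding g_def using carr by (simp add: O.m_assoc[symmetric])
    then have hg: "h \<circ> g = Q" by (simp add: orthogonal_group_def)
    let ?w = "p @ ret k @ corr g"
    have tail_walk: "awalk k (ret k @ corr g) j"
      using ret[OF k] corr[OF g] by (blast intro: awalk_appendI)
    have "awalk j ?w j" using p(1) tail_walk by (rule awalk_appendI)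
    moreover have "path_map T ?w = Q"
      using hg corr[OF g] by (simp add: h_def comp_assoc)
    moreover have "a * \<mu> * \<nu> * \<delta> \<le> walk_ratio r ?w"
    proof -
      have "(a * \<delta>) * (\<mu> * \<nu>) \<le> walk_ratio r p * (walk_ratio r (ret k) * walk_ratio r (corr g))"
        using p(3) walk_ratio_pos[OF p(1)] \<mu>(1) \<mu>(2)[OF k] \<nu>(1) \<nu>(2)[OF g] a(1) \<delta>(1)
        by (intro mult_mono) auto
      then show ?thesis by (simp add: mult_ac)
    qed
    moreover have "walk_ratio r ?w \<le> \<delta>"
    proof -
      have "walk_ratio r (ret k @ corr g) \<le> 1 ^ length (ret k @ corr g)"
        using awalk_set[OF tail_walk] edge_ratio by (intro walk_ratio_bounds(2)) force
      then have "walk_ratio r p * walk_ratio r (ret k @ corr g) \<le> \<delta> * 1"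
        using p(4) walk_ratio_pos[OF tail_walk] \<delta> by (intro mult_mono) auto
      then show ?thesis by simp
    qed
    moreover have "\<forall>y\<in>K j. dist x (walk_map r T v ?w y) \<le> D * \<delta>"
    proof
      fix y assume y: "y \<in> K j"
      from p(2) obtain u where u: "u \<in> K k" "x = walk_map r T v p u" by (elim imageE)
      define z where "z = walk_map r T v (ret k @ corr g) y"
      have z: "z \<in> K k"
        unfolding z_def by (rule subsetD[OF walk_map_image_subset[OF tail_walk] imageI[OF y]])
      have "dist x (walk_map r T v ?w y) = dist (walk_map r T v p u) (walk_map r T v p z)"
        by (simp add: u z_def)
      also have "\<dots> = walk_ratio r p * dist u z"
        using walk_map_is_similarity[OF p(1)] walk_ratio_pos[OF p(1)]
        by (metis less_imp_le similarity_orthogonal_dist)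
      also have "\<dots> \<le> \<delta> * D"
      proof (rule mult_mono)
        have "dist u z \<le> diameter (K k)"
          using u z K_compact[OF k] by (intro diameter_bounded_bound compact_imp_bounded)
        then show "dist u z \<le> D" using D(2)[OF k] by linarith
      qed (use p \<delta> in auto)
      finally show "dist x (walk_map r T v ?w y) \<le> D * \<delta>" by (simp add: mult.commute)
    qed
    ultimately show "\<exists>w. awalk j w j \<and> path_map T w = Q \<and> a * \<mu> * \<nu> * \<delta> \<le> walk_ratio r w \<and>
        walk_ratio r w \<le> \<delta> \<and> (\<forall>y\<in>K j. dist x (walk_map r T v w y) \<le> D * \<delta>)"
      by (intro exI[of _ ?w] conjI)
  qed
qed

text \<open>
  Let \<open>b < 1\<close> bound all edge ratios. At scale \<open>\<delta> = b ^ k\<close> there are at least of the order of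
  \<open>\<delta> powr (-s)\<close> points of \<open>K j\<close> with pairwise distances more than \<open>2 * D * \<delta>\<close>, so the cycles found
  near them have disjoint images. The ratios of these cycles are at least \<open>\<kappa> * \<delta>\<close>, so their lengths
  are at most \<open>k + k\<^sub>0\<close> and they have at most \<open>(k + k\<^sub>0 + 1) ^ E\<close> different ratios for \<open>E\<close> edges. By
  pigeonhole some ratio \<open>\<rho>\<close> occurs for at least the corresponding fraction of the cycles. The number
  of points grows at least exponentially in \<open>k\<close>, so lowering the exponent from \<open>s\<close> to \<open>t\<close> makes up for this
  polynomial loss once \<open>k\<close> is large.
\<close>

lemma disjoint_equal_cycles_exist:
  assumes j: "j \<in> verts G" and fin: "finite (transformation_group G T j)"
    and Q: "Q \<in> transformation_group G T j"
    and t: "0 < t" "t < s" and H: "hausdorff_measure s (K j) \<noteq> 0"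
  obtains \<rho> and P :: "'a set" and w where "0 < \<rho>" "\<rho> < 1" "finite P" "1 \<le> real (card P) * \<rho> powr t"
    "\<forall>x\<in>P. awalk j (w x) j \<and> path_map T (w x) = Q \<and> walk_ratio r (w x) = \<rho>"
    "disjoint_family_on (\<lambda>x. walk_map r T v (w x) ` K j) P"
proof -
  obtain \<kappa> D where \<kappa>: "0 < \<kappa>" and D: "0 < D" and
    cyc: "\<And>x \<delta>. x \<in> K j \<Longrightarrow> 0 < \<delta> \<Longrightarrow> \<delta> \<le> 1 \<Longrightarrow>
       \<exists>w. awalk j w j \<and> path_map T w = Q \<and> \<kappa> * \<delta> \<le> walk_ratio r w \<and> walk_ratio r w \<le> \<delta> \<and>
         (\<forall>y\<in>K j. dist x (walk_map r T v w y) \<le> D * \<delta>)"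
    using cycle_with_rotation_at_point[OF j fin Q] by metis
  have s: "0 < s" using t by simp
  obtain c \<eta>\<^sub>0 where c: "0 < c" and \<eta>\<^sub>0: "0 < \<eta>\<^sub>0" and
    many: "\<And>\<eta>. 0 < \<eta> \<Longrightarrow> \<eta> \<le> \<eta>\<^sub>0 \<Longrightarrow> \<exists>P. finite P \<and> P \<subseteq> K j \<and>
       (\<forall>x\<in>P. \<forall>y\<in>P. x \<noteq> y \<longrightarrow> \<eta> < dist x y) \<and> c \<le> real (card P) * \<eta> powr s"
    using positive_measure_many_separated_points[OF K_compact[OF j] s H] by metis
  obtain b where b: "0 < b" "b < 1" "\<And>e. e \<in> arcs G \<Longrightarrow> r e \<le> b"
    using edge_ratio_uniformly_below_1 by auto
  obtain k\<^sub>0 where k\<^sub>0: "b ^ k\<^sub>0 < \<kappa>" using real_arch_pow_inv[OF \<kappa> b(2)] by blast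
  define E where "E = card (arcs G)"
  \<comment> \<open>collecting the constants, the requirement on \<open>k\<close> becomes \<open>(k + k\<^sub>0 + 1) ^ E * \<gamma> ^ k < C\<close>\<close>
  define C where "C = c * (2 * D) powr (-s) * \<kappa> powr t"
  define \<gamma> where "\<gamma> = b powr (s - t)"
  have C: "0 < C" using c D \<kappa> by (simp add: C_def)
  have \<gamma>: "0 < \<gamma>" "\<gamma> < 1"
    using b t powr_less_mono2[of "s - t" b 1] by (simp_all add: \<gamma>_def)
  have "\<forall>\<^sub>F k in sequentially. (real k + real (k\<^sub>0 + 1)) ^ E * \<gamma> ^ k < C"
    using \<gamma> C by (rule polynomial_below_exponential)
  moreover have "\<forall>\<^sub>F k in sequentially. b ^ k < \<eta>\<^sub>0 / (2 * D)"
    using LIMSEQ_realpow_zero[of b] b \<eta>\<^sub>0 D by (intro order_tendstoD) auto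
  moreover have "\<forall>\<^sub>F k in sequentially. 1 \<le> k" by (rule eventually_ge_at_top)
  ultimately have "\<forall>\<^sub>F k in sequentially. (real k + real (k\<^sub>0 + 1)) ^ E * \<gamma> ^ k < C \<and>
      b ^ k < \<eta>\<^sub>0 / (2 * D) \<and> 1 \<le> k"
    by eventually_elim simp
  then obtain k where k: "(real k + real (k\<^sub>0 + 1)) ^ E * \<gamma> ^ k < C" "b ^ k < \<eta>\<^sub>0 / (2 * D)" "1 \<le> k"
    unfolding eventually_sequentially by blast
  define \<delta> where "\<delta> = b ^ k"
  have \<delta>: "0 < \<delta>" "\<delta> < 1" using b k(3) by (auto simp: \<delta>_def power_less_one_iff)
  have "0 < 2 * D * \<delta>" "2 * D * \<delta> \<le> \<eta>\<^sub>0" using D \<delta> k(2) by (simp_all add: \<delta>_def field_simps)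
  then obtain P where P: "finite P" "P \<subseteq> K j"
    and sep: "\<And>x y. x \<in> P \<Longrightarrow> y \<in> P \<Longrightarrow> x \<noteq> y \<Longrightarrow> 2 * D * \<delta> < dist x y"
    and cardP: "c \<le> real (card P) * (2 * D * \<delta>) powr s"
    using many[of "2 * D * \<delta>"] by blast
  have "\<forall>x\<in>P. \<exists>w. awalk j w j \<and> path_map T w = Q \<and> \<kappa> * \<delta> \<le> walk_ratio r w \<and> walk_ratio r w \<le> \<delta> \<and>
         (\<forall>y\<in>K j. dist x (walk_map r T v w y) \<le> D * \<delta>)"
  proof
    fix x assume "x \<in> P"
    then have "x \<in> K j" using P(2) by (rule rev_subsetD)
    then show "\<exists>w. awalk j w j \<and> path_map T w = Q \<and> \<kappa> * \<delta> \<le> walk_ratio r w \<and> walk_ratio r w \<le> \<delta> \<and>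
         (\<forall>y\<in>K j. dist x (walk_map r T v w y) \<le> D * \<delta>)"
      using \<delta> by (intro cyc) simp_all
  qed
  from bchoice[OF this] obtain w where w': "\<forall>x\<in>P. awalk j (w x) j \<and> path_map T (w x) = Q \<and>
      \<kappa> * \<delta> \<le> walk_ratio r (w x) \<and> walk_ratio r (w x) \<le> \<delta> \<and>
      (\<forall>y\<in>K j. dist x (walk_map r T v (w x) y) \<le> D * \<delta>)" ..
  then have w: "awalk j (w x) j" "path_map T (w x) = Q" "\<kappa> * \<delta> \<le> walk_ratio r (w x)"
    "walk_ratio r (w x) \<le> \<delta>" "\<And>y. y \<in> K j \<Longrightarrow> dist x (walk_map r T v (w x) y) \<le> D * \<delta>"
    if "x \<in> P" for x using that by simp_all
  have disj: "disjoint_family_on (\<lambda>x. walk_map r T v (w x) ` K j) P"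
    unfolding disjoint_family_on_def
  proof (intro ballI impI equals0I)
    fix x y z assume xy: "x \<in> P" "y \<in> P" "x \<noteq> y"
      and z: "z \<in> walk_map r T v (w x) ` K j \<inter> walk_map r T v (w y) ` K j"
    have "dist x z \<le> D * \<delta>" "dist y z \<le> D * \<delta>" using z w(5)[OF xy(1)] w(5)[OF xy(2)] by auto
    then have "dist x y \<le> 2 * D * \<delta>" using dist_triangle2[of x y z] by simp
    then show False using sep[OF xy] by simp
  qed
  define R where "R = {walk_ratio r p |p. set p \<subseteq> arcs G \<and> length p \<le> k + k\<^sub>0}"
  have R: "finite R" "card R \<le> (k + k\<^sub>0 + 1) ^ E"
    unfolding R_def E_def by (rule card_walk_ratios_le[OF finite_arcs])+
  have "walk_ratio r (w x) \<in> R" if x: "x \<in> P" for x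
  proof -
    have arcs: "set (w x) \<subseteq> arcs G" using w(1)[OF x] by (rule awalk_set)
    have "b ^ (k + k\<^sub>0) \<le> \<kappa> * \<delta>"
      using k\<^sub>0 \<delta>(1) by (simp add: \<delta>_def power_add mult.commute)
    also have "\<dots> \<le> walk_ratio r (w x)" by (rule w(3)[OF x])
    also have "\<dots> \<le> b ^ length (w x)"
      using arcs b(3) edge_ratio by (intro walk_ratio_bounds(2)) blast
    finally have "length (w x) \<le> k + k\<^sub>0" using b by (simp add: power_decreasing_iff)
    then show ?thesis using arcs unfolding R_def by blast
  qed
  then have "(\<lambda>x. walk_ratio r (w x)) \<in> P \<rightarrow> R" by blast
  moreover have "P \<noteq> {}" using cardP c by auto
  moreover from calculation have "R \<noteq> {}" by blast
  ultimately obtain \<rho> where \<rho>: "\<rho> \<in> R"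
    "card P \<le> card ((\<lambda>x. walk_ratio r (w x)) -` {\<rho>} \<inter> P) * card R"
    using pigeonhole_card[OF _ P(1) R(1)] by blast
  define P' where "P' = (\<lambda>x. walk_ratio r (w x)) -` {\<rho>} \<inter> P"
  have P': "P' \<subseteq> P" "finite P'" "\<And>x. x \<in> P' \<Longrightarrow> walk_ratio r (w x) = \<rho>"
    using P(1) by (auto simp: P'_def)
  have "card P > 0" using P(1) \<open>P \<noteq> {}\<close> by (simp add: card_gt_0_iff)
  then have "card P' \<noteq> 0" using \<rho>(2) unfolding P'_def by (metis mult_is_0 not_le)
  then obtain x\<^sub>0 where "x\<^sub>0 \<in> P'" by fastforce
  then have \<rho>b: "\<kappa> * \<delta> \<le> \<rho>" "\<rho> \<le> \<delta>" using w(3,4)[of x\<^sub>0] P' by auto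
  have \<rho>01: "0 < \<rho>" "\<rho> < 1" using \<rho>b \<delta> \<kappa> mult_pos_pos[of \<kappa> \<delta>] by linarith+
  have "1 \<le> real (card P') * \<rho> powr t"
  proof -
    let ?N = "(real k + real (k\<^sub>0 + 1)) ^ E"
    have N: "0 < ?N" by simp
    have \<delta>st: "\<delta> powr (-s) * \<delta> powr t * \<gamma> ^ k = 1"
    proof -
      have "\<gamma> ^ k = \<delta> powr (s - t)"
        using b by (simp add: \<gamma>_def \<delta>_def powr_realpow[symmetric] powr_powr mult.commute)
      then show ?thesis using \<delta> by (simp add: powr_add[symmetric])
    qed
    have "c * (2 * D * \<delta>) powr (-s) \<le> real (card P)"
      using cardP D \<delta> by (simp add: powr_minus field_simps)
    also have "\<dots> \<le> real (card P' * card R)" using \<rho>(2) unfolding P'_def by (simp only: of_nat_le_iff)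
    also have "\<dots> \<le> real (card P') * ?N"
      using R(2) by (simp add: of_nat_le_iff[symmetric, where ?'a = real] mult_left_mono add_ac del: of_nat_le_iff)
    finally have 1: "c * (2 * D * \<delta>) powr (-s) \<le> real (card P') * ?N" .
    have 2: "(\<kappa> * \<delta>) powr t \<le> \<rho> powr t" using \<rho>b(1) \<kappa> \<delta> t by (intro powr_mono2) auto
    have "c * (2 * D * \<delta>) powr (-s) * (\<kappa> * \<delta>) powr t \<le> (real (card P') * ?N) * \<rho> powr t"
      by (rule mult_mono[OF 1 2]) (use N in simp_all)
    also have "c * (2 * D * \<delta>) powr (-s) * (\<kappa> * \<delta>) powr t = C * (\<delta> powr (-s) * \<delta> powr t)"
      using D \<delta> \<kappa> by (simp add: C_def powr_mult mult_ac)
    finally have 3: "C * (\<delta> powr (-s) * \<delta> powr t) \<le> (real (card P') * ?N) * \<rho> powr t" .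
    have "?N * 1 = (?N * \<gamma> ^ k) * (\<delta> powr (-s) * \<delta> powr t)"
      using \<delta>st by (simp add: mult_ac)
    also have "\<dots> \<le> C * (\<delta> powr (-s) * \<delta> powr t)"
      using k(1) by (intro mult_right_mono) auto
    also note 3
    finally have "?N * 1 \<le> ?N * (real (card P') * \<rho> powr t)" by (simp add: mult_ac)
    then show ?thesis using N by (simp only: mult_le_cancel_left_pos)
  qed
  moreover have "disjoint_family_on (\<lambda>x. walk_map r T v (w x) ` K j) P'"
    using disjoint_family_on_mono[OF P'(1) disj] .
  moreover have "\<forall>x\<in>P'. awalk j (w x) j \<and> path_map T (w x) = Q \<and> walk_ratio r (w x) = \<rho>"
    using w(1,2) P'(1,3) by blast
  ultimately show ?thesis by (intro that[OF \<rho>01 P'(2)])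
qed

text \<open>
  The pieces of the attractor are disjoint because the larger images of \<open>K j\<close> are.
\<close>

lemma ss_system_of_disjoint_cycles:
  assumes j: "j \<in> verts G" and \<rho>: "0 < \<rho>" "\<rho> < 1" and P: "finite P" "P \<noteq> {}"
    and w: "\<And>x. x \<in> P \<Longrightarrow> awalk j (w x) j \<and> path_map T (w x) = Q \<and> walk_ratio r (w x) = \<rho>"
    and disj: "disjoint_family_on (\<lambda>x. walk_map r T v (w x) ` K j) P"
  shows "\<exists>u K'. ss_ifs (card P) (\<lambda>_. \<rho>) (\<lambda>_. Q) u \<and> ss_attractor (card P) (\<lambda>_. \<rho>) (\<lambda>_. Q) u K' \<and>
    strong_separation (card P) (\<lambda>_. \<rho>) (\<lambda>_. Q) u K' \<and> K' \<subseteq> K j"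
proof -
  obtain h where h: "bij_betw h {1..card P} P" using ex_bij_betw_nat_finite_1[OF P(1)] by blast
  have hP: "h i \<in> P" if "i \<in> {1..card P}" for i using h that by (auto simp: bij_betw_def)
  define u where "u i = walk_map r T v (w (h i)) 0" for i
  have sim: "similarity \<rho> Q (u i) = walk_map r T v (w (h i))" if "i \<in> {1..card P}" for i
    using walk_map_is_similarity(1)[of j "w (h i)" j] w[OF hP[OF that]] by (simp add: u_def)
  obtain x where "x \<in> P" using P(2) by blast
  then have Q: "orthogonal_transformation Q" using walk_map_is_similarity(2)[of j "w x" j] w by simp
  have "card P \<ge> 1" using P by (simp add: Suc_leI card_gt_0_iff)
  then have ifs: "ss_ifs (card P) (\<lambda>_. \<rho>) (\<lambda>_. Q) u" using \<rho> Q by (simp add: ss_ifs_def)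
  have inv: "similarity \<rho> Q (u i) ` K j \<subseteq> K j" if "i \<in> {1..card P}" for i
    unfolding sim[OF that] using w[OF hP[OF that]] by (intro walk_map_image_subset) simp
  have "\<exists>K'. ss_attractor (card P) (\<lambda>_. \<rho>) (\<lambda>_. Q) u K' \<and> K' \<subseteq> K j"
    using ifs K_compact[OF j] K_nonempty[OF j] inv by (rule ss_attractor_exists_within)
  then obtain K' where "ss_attractor (card P) (\<lambda>_. \<rho>) (\<lambda>_. Q) u K' \<and> K' \<subseteq> K j" ..
  then have K': "ss_attractor (card P) (\<lambda>_. \<rho>) (\<lambda>_. Q) u K'" "K' \<subseteq> K j" by simp_all
  have "strong_separation (card P) (\<lambda>_. \<rho>) (\<lambda>_. Q) u K'"
    unfolding strong_separation_def disjoint_family_on_def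
  proof (intro ballI impI)
    fix i i' assume i: "i \<in> {1..card P}" "i' \<in> {1..card P}" "i \<noteq> i'"
    then have "h i \<noteq> h i'" using inj_onD[OF bij_betw_imp_inj_on[OF h], of i i'] by metis
    then have "walk_map r T v (w (h i)) ` K j \<inter> walk_map r T v (w (h i')) ` K j = {}"
      using disjoint_family_onD[OF disj hP[OF i(1)] hP[OF i(2)]] by simp
    then show "similarity \<rho> Q (u i) ` K' \<inter> similarity \<rho> Q (u i') ` K' = {}"
      unfolding sim[OF i(1)] sim[OF i(2)] using K'(2) by blast
  qed
  with ifs K' show ?thesis by blast
qed

text \<open>
  If \<open>\<epsilon>\<close> exceeds the dimension, a single cycle suffices, as dimensions are nonnegative. Otherwise
  the exponents \<open>t - \<epsilon>/2 < t - \<epsilon>/4\<close> below the dimension \<open>t\<close> leave room for the loss in the choice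
  of a common ratio.
\<close>

lemma uniform_separated_subsystem_exists:
  assumes j: "j \<in> verts G" and fin: "finite (transformation_group G T j)"
    and Q: "Q \<in> transformation_group G T j" and \<epsilon>: "0 < \<epsilon>"
  shows "\<exists>\<rho>\<in>{0<..<1}. \<exists>m u K'. ss_ifs m (\<lambda>_. \<rho>) (\<lambda>_. Q) u \<and> ss_attractor m (\<lambda>_. \<rho>) (\<lambda>_. Q) u K' \<and>
    strong_separation m (\<lambda>_. \<rho>) (\<lambda>_. Q) u K' \<and> K' \<subseteq> K j \<and>
    hausdorff_dim (K j) - ereal \<epsilon> < hausdorff_dim K'"
proof -
  obtain t where t: "0 \<le> t" "hausdorff_dim (K j) = ereal t"
    by (rule compact_hausdorff_dim_real[OF K_compact[OF j]])
  show ?thesis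
  proof (cases "t < \<epsilon>")
    case True
    obtain x where x: "x \<in> K j" using K_nonempty[OF j] by blast
    obtain \<kappa> D where "0 < \<kappa>" "0 < D" and cyc: "\<And>x \<delta>. x \<in> K j \<Longrightarrow> 0 < \<delta> \<Longrightarrow> \<delta> \<le> 1 \<Longrightarrow>
       \<exists>w. awalk j w j \<and> path_map T w = Q \<and> \<kappa> * \<delta> \<le> walk_ratio r w \<and> walk_ratio r w \<le> \<delta> \<and>
         (\<forall>y\<in>K j. dist x (walk_map r T v w y) \<le> D * \<delta>)"
      using cycle_with_rotation_at_point[OF j fin Q] by metis
    from cyc[OF x, of "1/2"] obtain w where
      w: "awalk j w j \<and> path_map T w = Q \<and> walk_ratio r w \<le> 1/2" by auto
    then have ratio: "0 < walk_ratio r w" "walk_ratio r w < 1" using walk_ratio_pos[of j w j] by auto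
    have "\<exists>u K'. ss_ifs (card {x}) (\<lambda>_. walk_ratio r w) (\<lambda>_. Q) u \<and>
        ss_attractor (card {x}) (\<lambda>_. walk_ratio r w) (\<lambda>_. Q) u K' \<and>
        strong_separation (card {x}) (\<lambda>_. walk_ratio r w) (\<lambda>_. Q) u K' \<and> K' \<subseteq> K j"
      by (rule ss_system_of_disjoint_cycles[OF j ratio, where w = "\<lambda>_. w"])
        (use w in \<open>simp_all add: disjoint_family_on_def\<close>)
    moreover have "hausdorff_dim (K j) - ereal \<epsilon> < hausdorff_dim K'" for K' :: "'a set"
    proof -
      have "hausdorff_dim (K j) - ereal \<epsilon> < 0" using True by (simp add: t)
      also have "\<dots> \<le> hausdorff_dim K'" by (rule hausdorff_dim_nonneg)
      finally show ?thesis .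
    qed
    moreover have "walk_ratio r w \<in> {0<..<1}" using ratio by simp
    ultimately show ?thesis by blast
  next
    case False
    have s: "0 < t - \<epsilon>/2" "t - \<epsilon>/2 < t - \<epsilon>/4" using \<epsilon> False by auto
    have "hausdorff_measure (t - \<epsilon>/4) (K j) \<noteq> 0"
      using \<epsilon> False by (intro hausdorff_measure_nonzero_below_dim) (auto simp: t)
    then obtain \<rho> and P :: "'a set" and w where \<rho>: "0 < \<rho>" "\<rho> < 1" and P: "finite P"
      and card: "1 \<le> real (card P) * \<rho> powr (t - \<epsilon>/2)"
      and w: "\<forall>x\<in>P. awalk j (w x) j \<and> path_map T (w x) = Q \<and> walk_ratio r (w x) = \<rho>"
      and disj: "disjoint_family_on (\<lambda>x. walk_map r T v (w x) ` K j) P"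
      by (rule disjoint_equal_cycles_exist[OF j fin Q s])
    have "P \<noteq> {}" using card by auto
    from ss_system_of_disjoint_cycles[OF j \<rho> P this bspec[OF w] disj]
    obtain u K' where K': "ss_ifs (card P) (\<lambda>_. \<rho>) (\<lambda>_. Q) u"
      "ss_attractor (card P) (\<lambda>_. \<rho>) (\<lambda>_. Q) u K'"
      "strong_separation (card P) (\<lambda>_. \<rho>) (\<lambda>_. Q) u K'" "K' \<subseteq> K j" by blast
    have "hausdorff_dim (K j) - ereal \<epsilon> < ereal (t - \<epsilon>/2)" using \<epsilon> by (simp add: t)
    also have "\<dots> \<le> hausdorff_dim K'"
      using K'(1-3) s(1) card by (rule strong_separation_hausdorff_dim_ge)
    finally have "hausdorff_dim (K j) - ereal \<epsilon> < hausdorff_dim K'" .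
    moreover have "\<rho> \<in> {0<..<1}" using \<rho> by simp
    ultimately show ?thesis using K' by blast
  qed
qed

end

theorem corollary1p4:
  fixes G :: "(nat, 'e) pre_digraph"
    and q j :: nat
    and r :: "'e \<Rightarrow> real"
    and T :: "'e \<Rightarrow> real ^ 'd \<Rightarrow> real ^ 'd"
    and v :: "'e \<Rightarrow> real ^ 'd"
    and K :: "nat \<Rightarrow> (real ^ 'd) set"
  assumes "verts G = {1..q}"
    and "gd_ifs G r T v"
    and "strongly_connected G"
    and "gd_attractor G r T v K"
    and "\<exists>i\<in>{1..q}. \<exists>x\<in>K i. \<exists>y\<in>K i. x \<noteq> y"
    and "j \<in> {1..q}"
    and "finite (transformation_group G T j)"
  shows "\<forall>\<epsilon>>0. \<forall>Q\<in>transformation_group G T j.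
    \<exists>\<rho>\<in>{0<..<1}. \<exists>(m::nat) (r' :: nat \<Rightarrow> real) (T' :: nat \<Rightarrow> real ^ 'd \<Rightarrow> real ^ 'd)
        (v' :: nat \<Rightarrow> real ^ 'd) (K' :: (real ^ 'd) set).
      ss_ifs m r' T' v' \<and> ss_attractor m r' T' v' K' \<and> strong_separation m r' T' v' K' \<and>
      K' \<subseteq> K j \<and> hausdorff_dim (K j) - ereal \<epsilon> < hausdorff_dim K' \<and>
      (\<forall>i\<in>{1..m}. T' i = Q \<and> r' i = \<rho>)"
proof (intro allI impI ballI)
  fix \<epsilon> :: real and Q
  assume \<epsilon>: "0 < \<epsilon>" and Q: "Q \<in> transformation_group G T j"
  have "fin_digraph G" using assms(2) by (simp add: gd_ifs_def)
  then interpret strongly_connected_gd_ifs G r T v K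
    using assms(2-4)
    by (simp add: strongly_connected_gd_ifs_def strongly_connected_gd_ifs_axioms_def)
  have j: "j \<in> verts G" using assms(1,6) by simp
  from uniform_separated_subsystem_exists[OF j assms(7) Q \<epsilon>]
  obtain \<rho> m u K' where "\<rho> \<in> {0<..<1}"
    "ss_ifs m (\<lambda>_. \<rho>) (\<lambda>_. Q) u \<and> ss_attractor m (\<lambda>_. \<rho>) (\<lambda>_. Q) u K' \<and>
     strong_separation m (\<lambda>_. \<rho>) (\<lambda>_. Q) u K' \<and> K' \<subseteq> K j \<and>
     hausdorff_dim (K j) - ereal \<epsilon> < hausdorff_dim K'" by blast
  then show "\<exists>\<rho>\<in>{0<..<1}. \<exists>(m::nat) (r' :: nat \<Rightarrow> real) (T' :: nat \<Rightarrow> real ^ 'd \<Rightarrow> real ^ 'd)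
        (v' :: nat \<Rightarrow> real ^ 'd) (K' :: (real ^ 'd) set).
      ss_ifs m r' T' v' \<and> ss_attractor m r' T' v' K' \<and> strong_separation m r' T' v' K' \<and>
      K' \<subseteq> K j \<and> hausdorff_dim (K j) - ereal \<epsilon> < hausdorff_dim K' \<and>
      (\<forall>i\<in>{1..m}. T' i = Q \<and> r' i = \<rho>)"
    by (intro bexI[of _ \<rho>] exI[of _ m] exI[of _ "\<lambda>_. \<rho>"] exI[of _ "\<lambda>_. Q"]
        exI[of _ u] exI[of _ K']) simp_all
qed

end
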